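(* Let $(Z_n)_{n\ge0}$ be a linear fractional Galton–Watson process in i.i.d. random environment (as in the context) which is subcritical, i.e. $R^{(-1)}_\infty<\infty=R_\infty$ a.s.; for $0\le m\le n$ let $Z_{m,n}$ be the number of individuals of generation $m$ having at least one descendant in generation $n$. (a) Let $(m_n)_{n\ge1}$ be integers with $0\le m_n\le n$ and $n-m_n\to\infty$. Then $$\lim_{n\to\infty}\mathbb{E}\,\mathbf{P}^{(1:n)}(Z_{m_n,n}>1\mid Z_n>0)=0\quad\text{and}\quad \mathbf{P}^{(n:1)}(Z_{m_n,n}>1\mid Z_n>0)\xrightarrow{n\to\infty}0\ \text{a.s.}$$ If furthermore $\limsup_{n\to\infty}n^{-1}m_n<1$, $\mathbb{E}\log^2A<\infty$ and $\mathbb{E}\log^2B<\infty$, then also $\mathbf{P}^{(1:n)}(Z_{m_n,n}>1\mid Z_n>0)\to0$ a.s. (b) Fix $m\in\mathbb{N}$ and, given the environment, let $(Z^*_k)_{0\le k\le m}$ be a Galton–Watson process in varying environment with initial law $\mathrm{Geom}_+\big(\frac{1+R^{(-1)}_m}{1+R^{(-1)}_\infty}\big)$, in which each individual of generation $k$ ($0\le k\le m-1$) independently has offspring law $\mathrm{Geom}_+\big(\frac{1+R^{(-1)}_{m-k-1}}{1+R^{(-1)}_{m-k}}\big)$; denote its conditional law given the environment by $\mathbf{P}^{(m:1)}$. Then $$\big\|\mathbf{P}^{(n:1)}((Z_{k,n})_{n-m\le k\le n}\in\cdot\mid Z_n>0)-\mathbf{P}^{(m:1)}((Z^*_k)_{0\le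 k\le m}\in\cdot)\big\|\xrightarrow{n\to\infty}0\quad\text{a.s.}$$
   Context: Let $(A_n,B_n)_{n\ge1}$ be i.i.d. copies of $(A,B)$ with $\mathbb{P}(A>0,B>0,A+B\ge1)=1$; $e_n=(A_n,B_n)$. For $a,b>0$, $a+b\ge1$, $LF(a,b)$ is the distribution on $\mathbb{N}_0$ whose generating function $f$ satisfies $1/(1-f(s))=a/(1-s)+b$, $s\in[0,1)$. $\mathrm{Geom}_+(p)$ is the geometric law on $\{1,2,\dots\}$ with weights $p(1-p)^{k-1}$. $(Z_n)$, $Z_0=1$: given the environment, each individual of generation $k-1$ independently has offspring law $LF(A_k,B_k)$. $\Pi_0=1$, $\Pi_n=\prod_{k=1}^nA_k$, $R_n=\sum_{k=1}^n\Pi_{k-1}B_k$, $R_\infty=\lim R_n$, $R^{(-1)}_0=0$, $R^{(-1)}_n=\sum_{k=1}^n\Pi_k^{-1}B_k$, $R^{(-1)}_\infty=\lim R^{(-1)}_n$. $\mathbf{P}^{(1:n)}=\mathbb{P}(\cdot\mid e_1,\dots,e_n)$; $\mathbf{P}^{(n:1)}$ is the quenched law of the process in the reversed environment: given $(e_1,\dots,e_n)$, individuals of generation $k-1$ ($1\le k\le n$) have offspring law $LF(A_{n-k+1},B_{n-k+1})$. $\|\cdot\|$ is total variation. *)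

theory Defs
  imports "HOL-Probability.Probability"
begin

type_synonym env = "nat \<Rightarrow> real \<times> real"  (* e k = (A_k, B_k), used for k \<ge> 1 *)

definition LF :: "real \<Rightarrow> real \<Rightarrow> nat pmf" where
  "LF a b = (THE p. \<forall>s\<in>{0..<1::real}.
      1 / (1 - (\<Sum>k. pmf p k * s ^ k)) = a / (1 - s) + b)"

definition geom_plus :: "real \<Rightarrow> nat pmf" where
  "geom_plus p = map_pmf Suc (geometric_pmf p)"

definition Pi_env :: "env \<Rightarrow> nat \<Rightarrow> real" where
  "Pi_env e n = (\<Prod>k=1..n. fst (e k))"

definition R_env :: "env \<Rightarrow> nat \<Rightarrow> real" where
  "R_env e n = (\<Sum>k=1..n. Pi_env e (k - 1) * snd (e k))"

definition Rinv_env :: "env \<Rightarrow> nat \<Rightarrow> real" where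
  "Rinv_env e n = (\<Sum>k=1..n. snd (e k) / Pi_env e k)"

definition Rinv_inf :: "env \<Rightarrow> real" where
  "Rinv_inf e = lim (Rinv_env e)"

text \<open>Genealogical tree of a Galton-Watson process in varying environment, started
  from z individuals. The k-th entry of the list of offspring laws is the offspring
  law of generation k individuals.  The result is the list of generations, each
  generation being the list of offspring numbers of its individuals (in order;
  children of an individual are numbered contiguously in the next generation).\<close>
fun gw_tree :: "nat \<Rightarrow> nat pmf list \<Rightarrow> nat list list pmf" where
  "gw_tree z [] = return_pmf []"
| "gw_tree z (p # ps) = do {
      cs \<leftarrow> replicate_pmf z p;
      rest \<leftarrow> gw_tree (sum_list cs) ps;
      return_pmf (cs # rest) }"

definition tree_fwd :: "env \<Rightarrow> nat \<Rightarrow> nat list list pmf" where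
  "tree_fwd e n = gw_tree 1 (map (\<lambda>k. LF (fst (e k)) (snd (e k))) [1..<Suc n])"

definition tree_rev :: "env \<Rightarrow> nat \<Rightarrow> nat list list pmf" where
  "tree_rev e n = gw_tree 1 (map (\<lambda>k. LF (fst (e k)) (snd (e k))) (rev [1..<Suc n]))"

definition gen_size :: "nat list list \<Rightarrow> nat \<Rightarrow> nat" where
  "gen_size T k = (if k = 0 then 1 else sum_list (T ! (k - 1)))"

text \<open>For a tree suffix starting at some generation of size z, the list of
  indicators whether each individual of that generation has a descendant in the
  last generation.\<close>
fun alive :: "nat \<Rightarrow> nat list list \<Rightarrow> bool list" where
  "alive z [] = replicate z True"
| "alive z (cs # ts) =
     (let al = alive (sum_list cs) ts in
      map (\<lambda>i. \<exists>j\<in>{sum_list (take i cs)..<sum_list (take (Suc i) cs)}. al ! j)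
          [0..<length cs])"

text \<open>Z_{m,n}: number of individuals of generation m having at least one descendant
  in generation n, where n = length T.\<close>
definition Zred :: "nat list list \<Rightarrow> nat \<Rightarrow> nat" where
  "Zred T m = length (filter id (alive (gen_size T m) (drop m T)))"

definition qcond_prob :: "'a pmf \<Rightarrow> 'a set \<Rightarrow> 'a set \<Rightarrow> real" where
  "qcond_prob p S C = measure_pmf.prob p (S \<inter> C) / measure_pmf.prob p C"

fun gw_counts :: "nat \<Rightarrow> nat pmf list \<Rightarrow> nat list pmf" where
  "gw_counts z [] = return_pmf [z]"
| "gw_counts z (p # ps) = do {
      cs \<leftarrow> replicate_pmf z p;
      rest \<leftarrow> gw_counts (sum_list cs) ps;
      return_pmf (z # rest) }"

definition Zstar_law :: "env \<Rightarrow> nat \<Rightarrow> nat list pmf" where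
  "Zstar_law e m = bind_pmf
     (geom_plus ((1 + Rinv_env e m) / (1 + Rinv_inf e)))
     (\<lambda>z. gw_counts z (map (\<lambda>k. geom_plus ((1 + Rinv_env e (m - k - 1)) / (1 + Rinv_env e (m - k))))
                            [0..<m]))"

end

theory Submission
  imports Defs "HOL-Real_Asymp.Real_Asymp" "HOL-Library.Discrete_Functions"
begin

text \<open>
  Thinning a linear fractional law by an independent survival coin gives a linear fractional law
  again, and a linear fractional law conditioned to be positive is geometric. Hence, for a fixed
  environment and conditionally on survival, the sizes of the reduced generations
  \<open>Z\<^bsub>k,n\<^esub>\<close> form a Galton--Watson process with geometric offspring laws. A geometric sum of
  i.i.d. geometric variables is geometric, so \<open>Z\<^bsub>m,n\<^esub>\<close> itself is geometric, with explicit
  parameter: \<open>Z\<^bsub>m,n\<^esub> > 1\<close> has conditional probability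
  \<open>R\<^bsub>m\<^esub> / (\<Pi>\<^bsub>n\<^esub> + R\<^bsub>n\<^esub>)\<close> in the forward environment and
  \<open>1 - (1 + R\<^bsup>(-1)\<^esup>\<^bsub>n-m\<^esub>) / (1 + R\<^bsup>(-1)\<^esup>\<^bsub>n\<^esub>)\<close> in the reversed one.
  The reversed statements are then immediate from the convergence of \<open>R\<^bsup>(-1)\<^esup>\<close>, and the annealed
  forward statement follows by exchangeability.
  For the quenched forward statement, subcriticality forces \<open>E log A > 0\<close> (otherwise the central
  limit theorem keeps \<open>P(\<Pi>\<^bsub>n\<^esub> \<le> 1)\<close> bounded away from 0, contradicting
  \<open>B\<^bsub>n\<^esub> / \<Pi>\<^bsub>n\<^esub> \<rightarrow> 0\<close>), and the law of large numbers for \<open>log A\<close> and \<open>log B\<close>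
  gives exponential decay. For (b), the limiting process and the reduced process at time \<open>n\<close> start
  from geometric laws whose parameters have a ratio tending to 1, and otherwise have the same
  offspring laws.
\<close>

section \<open>Generating functions and linear fractional laws\<close>

definition pgf :: "nat pmf \<Rightarrow> real \<Rightarrow> real" where
  "pgf p s = measure_pmf.expectation p (\<lambda>k. s ^ k)"

text \<open>Boundedness makes every integral finite, so the iterated-integral identity for
  nonnegative integrals passes to real expectations.\<close>

lemma expectation_bind_pmf:
  fixes f :: "'b \<Rightarrow> real"
  assumes "\<And>y. 0 \<le> f y" and "\<And>y. f y \<le> B"
  shows "measure_pmf.expectation (bind_pmf p q) f
       = measure_pmf.expectation p (\<lambda>x. measure_pmf.expectation (q x) f)"
proof -
  have int: "integrable (measure_pmf r) f" for r
    by (rule measure_pmf.integrable_const_bound[where B = B]) (use assms in auto)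
  have nonneg: "0 \<le> measure_pmf.expectation r f" for r
    by (simp add: assms(1))
  have le: "measure_pmf.expectation r f \<le> B" for r
    by (rule measure_pmf.integral_le_const) (use assms int in auto)
  have int': "integrable (measure_pmf p) (\<lambda>x. measure_pmf.expectation (q x) f)"
    by (rule measure_pmf.integrable_const_bound[where B = B]) (use nonneg le in auto)
  have "ennreal (measure_pmf.expectation (bind_pmf p q) f) = (\<integral>\<^sup>+ x. \<integral>\<^sup>+ y. f y \<partial>q x \<partial>p)"
    by (subst nn_integral_eq_integral[symmetric]) (use int assms in auto)
  also have "\<dots> = ennreal (measure_pmf.expectation p (\<lambda>x. measure_pmf.expectation (q x) f))"
    using int assms(1) nonneg int' by (simp add: nn_integral_eq_integral)
  finally show ?thesis
    using nonneg assms(1) by (subst (asm) ennreal_inj) auto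
qed

lemma integrable_pow_pmf:
  fixes s :: real
  assumes "0 \<le> s" "s \<le> 1"
  shows "integrable (measure_pmf p) (\<lambda>k. s ^ f k)"
  by (rule measure_pmf.integrable_const_bound[where B = 1]) (use assms in \<open>auto simp: power_le_one\<close>)

lemma pgf_sums:
  assumes "0 \<le> s" "s \<le> 1"
  shows "(\<lambda>k. pmf p k * s ^ k) sums pgf p s"
proof -
  have "integrable (count_space UNIV) (\<lambda>k. pmf p k * s ^ k)"
    using integrable_pow_pmf[OF assms, where p=p and f="\<lambda>x. x"]
    by (simp add: measure_pmf_eq_density integrable_density)
  from sums_integral_count_space_nat[OF this]
  have "(\<lambda>k. pmf p k * s ^ k) sums (\<integral>k. pmf p k * s ^ k \<partial>count_space UNIV)" .
  also have "(\<integral>k. pmf p k * s ^ k \<partial>count_space UNIV) = pgf p s"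
    unfolding pgf_def measure_pmf_eq_density[of p] by (subst integral_density) auto
  finally show ?thesis .
qed

lemma pgf_bind:
  assumes "0 \<le> s" "s \<le> 1"
  shows "pgf (bind_pmf p q) s = measure_pmf.expectation p (\<lambda>x. pgf (q x) s)"
  unfolding pgf_def by (rule expectation_bind_pmf[where B = 1]) (use assms in \<open>auto simp: power_le_one\<close>)

lemma pgf_return [simp]: "pgf (return_pmf n) s = s ^ n"
  by (simp add: pgf_def)

text \<open>Strong induction: once the lower coefficients vanish, dividing by \<open>x ^ n\<close>
  leaves a series that is zero for small positive \<open>x\<close> and tends to \<open>d n\<close>.
  The limit is taken from the right because the hypothesis covers only nonnegative
  \<open>s\<close>.\<close>

lemma power_series_eq_0:
  fixes d :: "nat \<Rightarrow> real"
  assumes bnd: "\<And>k. \<bar>d k\<bar> \<le> B" and 0: "\<And>s. 0 \<le> s \<Longrightarrow> s < 1 \<Longrightarrow> (\<lambda>k. d k * s ^ k) sums 0"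
  shows "d n = 0"
proof (induction n rule: less_induct)
  case (less n)
  have summ: "summable (\<lambda>k. d (k + n) * x ^ k)" if "norm x < 1" for x :: real
  proof (rule summable_comparison_test')
    show "summable (\<lambda>k. B * \<bar>x\<bar> ^ k)"
      using that by (intro summable_mult summable_geometric) auto
    show "norm (d (k + n) * x ^ k) \<le> B * \<bar>x\<bar> ^ k" if "k \<ge> 0" for k
      by (auto simp: abs_mult power_abs intro!: mult_right_mono bnd)
  qed
  define f where "f x = (\<Sum>k. d (k + n) * x ^ k)" for x
  have lim: "(f \<longlongrightarrow> d (0 + n)) (at 0)"
    by (rule powser_limit_0[where s = 1 and a = "\<lambda>k. d (k + n)"])
       (use summ in \<open>auto simp: f_def intro!: summable_sums\<close>)
  have "f x = 0" if "0 < x" "x < 1" for x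
  proof -
    have "(\<lambda>k. d (k + n) * x ^ (k + n)) sums (0 - (\<Sum>k<n. d k * x ^ k))"
      using 0[of x] that by (subst sums_iff_shift) (auto simp: less)
    then have "(\<lambda>k. d (k + n) * x ^ (k + n)) sums 0"
      using less by simp
    from sums_divide[OF this, of "x ^ n"] have "(\<lambda>k. d (k + n) * x ^ k) sums 0"
      using that by (simp add: power_add)
    then show ?thesis
      by (simp add: f_def sums_unique[symmetric])
  qed
  then have "eventually (\<lambda>x. f x = 0) (at_right 0)"
    using eventually_at_right_real[of 0 "1::real"] by (auto elim: eventually_mono)
  then have "(f \<longlongrightarrow> 0) (at_right 0)"
    by (simp add: tendsto_eventually)
  moreover have "(f \<longlongrightarrow> d n) (at_right 0)"
    using lim by (simp add: filterlim_at_split)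
  ultimately show ?case
    using tendsto_unique trivial_limit_at_right_real by blast
qed

lemma pgf_eqI:
  assumes "\<And>s. 0 \<le> s \<Longrightarrow> s < 1 \<Longrightarrow> pgf p s = pgf q s"
  shows "p = q"
proof (rule pmf_eqI)
  fix n
  have "pmf p n - pmf q n = 0"
  proof (rule power_series_eq_0[where B = 1])
    show "\<bar>pmf p k - pmf q k\<bar> \<le> 1" for k
      using pmf_le_1[of p k] pmf_le_1[of q k] pmf_nonneg[of p k] pmf_nonneg[of q k] by linarith
    show "(\<lambda>k. (pmf p k - pmf q k) * s ^ k) sums 0" if "0 \<le> s" "s < 1" for s
      using sums_diff[OF pgf_sums[of s p] pgf_sums[of s q]] that assms[of s]
      by (simp add: algebra_simps)
  qed
  then show "pmf p n = pmf q n"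
    by simp
qed

section \<open>Closed forms for geometric and linear fractional laws\<close>

lemma pgf_geom_plus:
  assumes p: "0 < p" "p \<le> 1" and s: "0 \<le> s" "s < 1"
  shows "pgf (geom_plus p) s = p * s / (1 - (1 - p) * s)"
proof -
  have lt: "(1 - p) * s < 1"
    using p s by (smt (verit) mult_left_le_one_le)
  have "pgf (geom_plus p) s = s * pgf (geometric_pmf p) s"
    by (simp add: pgf_def geom_plus_def)
  moreover have "(\<lambda>k. p * ((1 - p) * s) ^ k) sums (p * (1 / (1 - (1 - p) * s)))"
    using lt p s by (intro sums_mult geometric_sums) auto
  then have "pgf (geometric_pmf p) s = p * (1 / (1 - (1 - p) * s))"
    using pgf_sums[of s "geometric_pmf p"] p s sums_unique2
    by (fastforce simp: power_mult_distrib mult_ac)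
  ultimately show ?thesis
    by simp
qed

lemma set_pmf_geom_plus: "k \<in> set_pmf (geom_plus p) \<Longrightarrow> 0 < k"
  by (auto simp: geom_plus_def)

text \<open>With \<open>p\<close> geometric on the positive integers this is the normal form of a
  linear fractional law: a coin decides between no children and a geometric number of them.\<close>

definition zmix :: "real \<Rightarrow> nat pmf \<Rightarrow> nat pmf" where
  "zmix u p = do {b \<leftarrow> bernoulli_pmf u; if b then p else return_pmf 0}"

lemma pgf_zmix:
  assumes "0 \<le> u" "u \<le> 1" "0 \<le> s" "s < 1"
  shows "pgf (zmix u p) s = 1 - u * (1 - pgf p s)"
  unfolding zmix_def using assms by (subst pgf_bind) (auto simp: algebra_simps)

text \<open>The right-hand side is the solution \<open>f\<close> of
  \<open>1 / (1 - f) = a / (1 - s) + b\<close>; its value at \<open>s = 0\<close> dictates the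
  weight \<open>1 / (a + b)\<close>.\<close>

lemma pgf_LF_formula:
  assumes "0 < a" "0 < b" "1 \<le> a + b" "0 \<le> s" "s < 1"
  shows "pgf (zmix (1 / (a + b)) (geom_plus (a / (a + b)))) s = 1 - (1 - s) / (a + b * (1 - s))"
proof -
  define c where "c = a + b"
  define d where "d = a + b * (1 - s)"
  have pos: "0 < d" "0 < c"
    using assms unfolding c_def d_def by (auto intro!: add_pos_pos)
  have c: "1 \<le> c" "a \<le> c" "1 - a / c = b / c"
    using assms pos by (auto simp: c_def field_simps)
  have "pgf (geom_plus (a / c)) s = a / c * s / (1 - b / c * s)"
    using assms c pos by (simp add: pgf_geom_plus)
  also have "1 - b / c * s = d / c"
    using pos by (simp add: c_def d_def field_simps)
  also have "a / c * s / (d / c) = a * s / d"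
    using pos by simp
  also have "\<dots> = 1 - c * (1 - s) / d"
    using pos by (simp add: field_simps) (simp add: c_def d_def algebra_simps)
  finally have "pgf (geom_plus (a / c)) s = 1 - c * (1 - s) / d" .
  then show ?thesis
    using assms c pos by (simp add: pgf_zmix flip: c_def d_def)
qed

text \<open>The definite description denotes: the mixture solves the defining equation, and every
  solution has the same generating function, hence is the same law.\<close>

lemma LF_eq_zmix:
  assumes ab: "0 < a" "0 < b" "1 \<le> a + b"
  shows "LF a b = zmix (1 / (a + b)) (geom_plus (a / (a + b)))" (is "_ = ?q")
  unfolding LF_def
proof (rule the_equality)
  have sum_eq: "(\<Sum>k. pmf p k * s ^ k) = pgf p s" if "s \<in> {0..<1}" for p s
    using pgf_sums[of s p] that by (auto simp: sums_iff)
  have pos: "0 < a + b * (1 - s)" if "s \<in> {0..<1}" for s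
    using that ab by (intro add_pos_pos) auto
  show "\<forall>s\<in>{0..<1::real}. 1 / (1 - (\<Sum>k. pmf ?q k * s ^ k)) = a / (1 - s) + b"
    using pos ab by (fastforce simp: sum_eq pgf_LF_formula add_divide_distrib)
  fix p
  assume p: "\<forall>s\<in>{0..<1::real}. 1 / (1 - (\<Sum>k. pmf p k * s ^ k)) = a / (1 - s) + b"
  show "p = ?q"
  proof (rule pgf_eqI)
    fix s :: real assume s: "0 \<le> s" "s < 1"
    have "1 / (1 - pgf p s) = (a + b * (1 - s)) / (1 - s)"
      using bspec[OF p, of s] s by (simp add: sum_eq add_divide_distrib)
    then have "1 - pgf p s = (1 - s) / (a + b * (1 - s))"
      by (metis inverse_divide inverse_eq_divide inverse_inverse_eq)
    then show "pgf p s = pgf ?q s"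
      using s ab by (simp add: pgf_LF_formula)
  qed
qed

section \<open>Thinning of linear fractional laws and compounding of geometric laws\<close>

definition count_true :: "bool list \<Rightarrow> nat" where
  "count_true xs = length (filter id xs)"

lemma count_true_simps [simp]:
  "count_true [] = 0"
  "count_true (x # xs) = (if x then 1 else 0) + count_true xs"
  "count_true (xs @ ys) = count_true xs + count_true ys"
  "count_true (replicate n True) = n"
  by (auto simp: count_true_def)

text \<open>In the application \<open>\<sigma>\<close> is the probability that a child has a
  descendant in the last generation, so this is the law of the number of such children.\<close>

definition thin :: "nat pmf \<Rightarrow> real \<Rightarrow> nat pmf" where
  "thin p \<sigma> = do {c \<leftarrow> p; map_pmf count_true (replicate_pmf c (bernoulli_pmf \<sigma>))}"

text \<open>\<open>F\<close> is an abstract additive functional of lists, so that one product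
  formula serves both \<open>count_true\<close> and \<open>sum_list\<close>.\<close>

lemma pgf_sum_replicate:
  fixes f :: "'a \<Rightarrow> nat" and F :: "'a list \<Rightarrow> nat"
  assumes s: "0 \<le> s" "s \<le> 1" and F: "F [] = 0" "\<And>x xs. F (x # xs) = f x + F xs"
  shows "pgf (map_pmf F (replicate_pmf n p)) s = pgf (map_pmf f p) s ^ n"
proof (induction n)
  case 0
  then show ?case
    by (simp add: F)
next
  case (Suc n)
  have "map_pmf F (replicate_pmf (Suc n) p)
      = do {x \<leftarrow> p; map_pmf (\<lambda>k. f x + k) (map_pmf F (replicate_pmf n p))}"
    by (simp add: map_bind_pmf map_pmf_def[symmetric] pmf.map_comp o_def F)
  then have "pgf (map_pmf F (replicate_pmf (Suc n) p)) s
      = measure_pmf.expectation p (\<lambda>x. pgf (map_pmf (\<lambda>k. f x + k) (map_pmf F (replicate_pmf n p))) s)"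
    using s by (simp add: pgf_bind)
  also have "\<dots> = measure_pmf.expectation p (\<lambda>x. s ^ f x * pgf (map_pmf F (replicate_pmf n p)) s)"
    by (simp add: pgf_def power_add)
  also have "\<dots> = pgf (map_pmf f p) s * pgf (map_pmf F (replicate_pmf n p)) s"
    by (simp add: pgf_def)
  finally show ?case
    using Suc by simp
qed

lemma pgf_thin:
  assumes "0 \<le> \<sigma>" "\<sigma> \<le> 1" "0 \<le> s" "s \<le> 1"
  shows "pgf (thin p \<sigma>) s = pgf p (1 - \<sigma> + \<sigma> * s)"
proof -
  have "pgf (map_pmf (\<lambda>x. if x then 1 else 0) (bernoulli_pmf \<sigma>)) s = 1 - \<sigma> + \<sigma> * s"
    using assms by (simp add: pgf_def)
  then have "pgf (map_pmf count_true (replicate_pmf c (bernoulli_pmf \<sigma>))) s = (1 - \<sigma> + \<sigma> * s) ^ c" for c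
    using pgf_sum_replicate[OF assms(3,4), of count_true "\<lambda>x. if x then 1 else 0"] by simp
  then show ?thesis
    unfolding thin_def using assms by (subst pgf_bind) (auto simp: pgf_def[of p])
qed

text \<open>Thinning replaces \<open>s\<close> by \<open>s'\<close> with
  \<open>1 - s' = (1 - s) / t\<close>. In the linear fractional formula this amounts to replacing
  \<open>a\<close> by \<open>a * t\<close> and keeping \<open>b\<close>.\<close>

lemma thin_LF:
  assumes ab: "0 < a" "0 < b" "1 \<le> a + b" and t: "1 \<le> t"
  shows "thin (LF a b) (1 / t) = zmix (1 / (a * t + b)) (geom_plus (a * t / (a * t + b)))"
proof (rule pgf_eqI)
  fix s :: real assume s: "0 \<le> s" "s < 1"
  have "a * 1 \<le> a * t"
    using ab t by (intro mult_left_mono) auto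
  then have at: "1 \<le> a * t + b" "0 < a * t"
    using ab by linarith+
  define s' where "s' = 1 - 1 / t + 1 / t * s"
  have eq: "1 - s' = (1 - s) / t"
    by (simp add: s'_def diff_divide_distrib)
  have "(1 - s) / t \<le> 1"
    using t s by (simp add: field_simps)
  moreover have "0 < (1 - s) / t"
    using t s by simp
  ultimately have s': "0 \<le> s'" "s' < 1"
    using eq by linarith+
  have "pgf (thin (LF a b) (1 / t)) s = pgf (LF a b) s'"
    using t s by (simp add: pgf_thin s'_def)
  also have "\<dots> = 1 - (1 - s') / (a + b * (1 - s'))"
    using LF_eq_zmix[OF ab] pgf_LF_formula[OF ab s'] by simp
  also have "\<dots> = 1 - (1 - s) / (a * t + b * (1 - s))"
  proof -
    have "a + b * ((1 - s) / t) = (a * t + b * (1 - s)) / t"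
      using t by (simp add: add_divide_distrib)
    then show ?thesis
      unfolding eq using t by simp
  qed
  also have "\<dots> = pgf (zmix (1 / (a * t + b)) (geom_plus (a * t / (a * t + b)))) s"
    using ab(2) at s by (simp add: pgf_LF_formula)
  finally show "pgf (thin (LF a b) (1 / t)) s
      = pgf (zmix (1 / (a * t + b)) (geom_plus (a * t / (a * t + b)))) s" .
qed

text \<open>For \<open>s > 0\<close> a geometric generating function \<open>f\<close> satisfies
  \<open>1 / f - 1 = (1 / s - 1) / p\<close>, so composition multiplies the parameters.\<close>

lemma geom_plus_compose:
  assumes "0 < p" "p \<le> 1" "0 < q" "q \<le> 1"
  shows "bind_pmf (geom_plus q) (\<lambda>z. map_pmf sum_list (replicate_pmf z (geom_plus p)))
       = geom_plus (q * p)"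
proof (rule pgf_eqI)
  fix s :: real assume s: "0 \<le> s" "s < 1"
  define f where "f = pgf (geom_plus p) s"
  have pos: "0 < 1 - (1 - p) * s"
    using assms s by (smt (verit) mult_left_le_one_le)
  have pos': "0 < 1 - (1 - q * p) * s"
    using assms s by (smt (verit) mult_left_le_one_le mult_pos_pos mult_le_one)
  have f: "f = p * s / (1 - (1 - p) * s)"
    using assms s by (simp add: f_def pgf_geom_plus)
  have f01: "0 \<le> f" "f < 1"
    using pos s by (auto simp: f divide_less_eq algebra_simps assms(1) less_imp_le)
  have "pgf (map_pmf sum_list (replicate_pmf z (geom_plus p))) s = f ^ z" for z
    using pgf_sum_replicate[of s sum_list "\<lambda>x. x"] s by (simp add: f_def)
  then have "pgf (bind_pmf (geom_plus q) (\<lambda>z. map_pmf sum_list (replicate_pmf z (geom_plus p)))) s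
      = pgf (geom_plus q) f"
    using s by (subst pgf_bind) (auto simp: pgf_def[of "geom_plus q"])
  also have "\<dots> = q * f / (1 - (1 - q) * f)"
    using f01 assms by (simp add: pgf_geom_plus)
  also have "\<dots> = q * p * s / (1 - (1 - q * p) * s)"
  proof -
    have "1 - (1 - q) * f = (1 - (1 - q * p) * s) / (1 - (1 - p) * s)"
      using pos by (simp add: f field_simps)
    then show ?thesis
      using pos pos' by (simp add: f)
  qed
  also have "\<dots> = pgf (geom_plus (q * p)) s"
    using assms s by (simp add: pgf_geom_plus mult_le_one)
  finally show "pgf (bind_pmf (geom_plus q) (\<lambda>z. map_pmf sum_list (replicate_pmf z (geom_plus p)))) s
      = pgf (geom_plus (q * p)) s" .
qed

section \<open>The reduced genealogical tree\<close>

text \<open>In the environment list \<open>l\<close>, \<open>1 / isv l\<close> is the probability that one individual has a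
  descendant in the last generation, and \<open>geoms l\<close> lists the offspring laws of the reduced tree.\<close>

fun isv :: "(real \<times> real) list \<Rightarrow> real" where
  "isv [] = 1"
| "isv (x # l) = fst x * isv l + snd x"

fun geoms :: "(real \<times> real) list \<Rightarrow> nat pmf list" where
  "geoms [] = []"
| "geoms (x # l) = geom_plus (fst x * isv l / isv (x # l)) # geoms l"

definition admissible :: "real \<times> real \<Rightarrow> bool" where
  "admissible x \<longleftrightarrow> 0 < fst x \<and> 0 < snd x \<and> 1 \<le> fst x + snd x"

lemma isv_ge_1: "(\<And>x. x \<in> set l \<Longrightarrow> admissible x) \<Longrightarrow> 1 \<le> isv l"
proof (induction l)
  case (Cons x l)
  then have "1 \<le> isv l" "0 < fst x" "1 \<le> fst x + snd x"
    by (auto simp: admissible_def)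
  then have "fst x * 1 \<le> fst x * isv l"
    by (intro mult_left_mono) auto
  then show ?case
    using \<open>1 \<le> fst x + snd x\<close> by simp
qed simp

lemma geom_param_bounds:
  assumes "\<And>y. y \<in> set (x # l) \<Longrightarrow> admissible y"
  shows "0 < fst x * isv l / isv (x # l)" "fst x * isv l / isv (x # l) \<le> 1"
proof -
  have *: "1 \<le> isv l" "1 \<le> isv (x # l)" "0 < fst x" "0 < snd x"
    using assms isv_ge_1[of l] isv_ge_1[of "x # l"] by (auto simp: admissible_def)
  then show "0 < fst x * isv l / isv (x # l)"
    by (intro divide_pos_pos mult_pos_pos) linarith+
  show "fst x * isv l / isv (x # l) \<le> 1"
    using * by (auto simp: divide_le_eq_1)
qed

text \<open>The recursive form of one step of \<open>alive\<close>: \<open>grp cs al\<close> cuts \<open>al\<close> into sibling groups of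
  sizes \<open>cs\<close> and tells which groups contain a survivor.\<close>

fun grp :: "nat list \<Rightarrow> bool list \<Rightarrow> bool list" where
  "grp [] al = []"
| "grp (c # cs) al = (True \<in> set (take c al)) # grp cs (drop c al)"

lemma grp_eq_map:
  assumes "length al = sum_list cs"
  shows "map (\<lambda>i. \<exists>j\<in>{sum_list (take i cs)..<sum_list (take (Suc i) cs)}. al ! j) [0..<length cs]
       = grp cs al"
  using assms
proof (induction cs arbitrary: al)
  case (Cons c cs)
  have shift: "(\<exists>j\<in>{c + x..<c + y}. al ! j) \<longleftrightarrow> (\<exists>j\<in>{x..<y}. drop c al ! j)" for x y
  proof -
    have "(\<exists>j\<in>{c + x..<c + y}. al ! j) \<longleftrightarrow> (\<exists>j\<in>(+) c ` {x..<y}. al ! j)"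
      unfolding image_add_atLeastLessThan by (simp add: add.commute)
    then show ?thesis
      using Cons.prems by (simp del: image_add_atLeastLessThan)
  qed
  have "(\<exists>j\<in>{0..<c}. al ! j) \<longleftrightarrow> True \<in> set (take c al)"
    using Cons.prems by (auto simp: in_set_conv_nth)
  moreover have "[0..<length (c # cs)] = 0 # map Suc [0..<length cs]"
    by (simp add: upt_conv_Cons map_Suc_upt del: upt_Suc)
  ultimately show ?case
    using Cons.IH[of "drop c al"] Cons.prems by (simp add: shift o_def del: upt_Suc)
qed simp

text \<open>The shape of every tree that \<open>gw_tree\<close> produces. It guarantees that the
  positions looked up by \<open>alive\<close> lie inside the list of the next generation.\<close>

fun consistent :: "nat \<Rightarrow> nat list list \<Rightarrow> bool" where
  "consistent z [] = True"
| "consistent z (cs # ts) = (length cs = z \<and> consistent (sum_list cs) ts)"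

lemma alive_length: "consistent z T \<Longrightarrow> length (alive z T) = z"
  by (cases T) (auto simp: Let_def)

lemma alive_Cons_grp:
  "consistent z (cs # ts) \<Longrightarrow> alive z (cs # ts) = grp cs (alive (sum_list cs) ts)"
  using grp_eq_map[OF alive_length[of "sum_list cs" ts]] by (simp add: Let_def)

lemma gw_tree_support:
  "T \<in> set_pmf (gw_tree z ps) \<Longrightarrow> consistent z T \<and> length T = length ps"
  by (induction ps arbitrary: z T) (auto simp: set_replicate_pmf)

text \<open>The sizes of all reduced generations of a tree suffix starting from \<open>z\<close> individuals.\<close>

fun cnt :: "nat \<Rightarrow> nat list list \<Rightarrow> nat list" where
  "cnt z [] = [z]"
| "cnt z (cs # ts) = count_true (alive z (cs # ts)) # cnt (sum_list cs) ts"

lemma length_cnt [simp]: "length (cnt z T) = Suc (length T)"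
  by (induction z T rule: cnt.induct) auto

lemma cnt_nth:
  "m \<le> length T \<Longrightarrow>
    cnt z T ! m = count_true (alive (if m = 0 then z else sum_list (T ! (m - 1))) (drop m T))"
proof (induction z T arbitrary: m rule: cnt.induct)
  case (2 z cs ts)
  show ?case
  proof (cases m)
    case (Suc k)
    then show ?thesis
      using "2.IH"[of k] "2.prems" by (cases k) auto
  qed simp
qed simp

lemma Zred_eq_cnt: "m \<le> length T \<Longrightarrow> Zred T m = cnt 1 T ! m"
  by (simp add: Zred_def gen_size_def cnt_nth count_true_def)

lemma map_Zred_eq_drop_cnt: "map (Zred T) [j..<Suc (length T)] = drop j (cnt 1 T)"
  by (rule nth_equalityI) (auto simp: Zred_eq_cnt simp del: upt_Suc)

lemma gen_size_eq_last_cnt: "gen_size T (length T) = last (cnt 1 T)"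
proof -
  have "last (cnt 1 T) = cnt 1 T ! length T"
    by (subst last_conv_nth) (auto simp flip: length_0_conv)
  then show ?thesis
    by (simp add: cnt_nth gen_size_def)
qed

section \<open>Joint law of survival marks and reduced generation sizes\<close>

lemma count_true_pos: "0 < count_true al \<longleftrightarrow> True \<in> set al"
  by (induction al) auto

text \<open>Because \<open>g\<close> charges only positive numbers, the coin hidden in
  \<open>zmix\<close> can be read off the count: it is \<open>True\<close> exactly when the family
  has a survivor.\<close>

lemma thin_alive_count:
  assumes thin: "thin p \<sigma> = zmix u g" and g: "\<And>k. k \<in> set_pmf g \<Longrightarrow> 0 < k"
  shows "do {c \<leftarrow> p; al \<leftarrow> replicate_pmf c (bernoulli_pmf \<sigma>); return_pmf (True \<in> set al, count_true al)}
       = do {b \<leftarrow> bernoulli_pmf u; k \<leftarrow> if b then g else return_pmf 0; return_pmf (b, k)}"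
proof -
  have "do {c \<leftarrow> p; al \<leftarrow> replicate_pmf c (bernoulli_pmf \<sigma>); return_pmf (True \<in> set al, count_true al)}
      = map_pmf (\<lambda>k. (0 < k, k)) (thin p \<sigma>)"
    by (simp add: thin_def map_bind_pmf pmf.map_comp o_def count_true_pos map_pmf_def[symmetric])
  also have "\<dots> = do {b \<leftarrow> bernoulli_pmf u; map_pmf (\<lambda>k. (0 < k, k)) (if b then g else return_pmf 0)}"
    by (simp add: thin zmix_def map_bind_pmf)
  also have "\<dots> = do {b \<leftarrow> bernoulli_pmf u; map_pmf (\<lambda>k. (b, k)) (if b then g else return_pmf 0)}"
    by (intro bind_pmf_cong refl) (auto intro!: map_pmf_cong dest: g)
  finally show ?thesis
    by (simp add: map_pmf_def)
qed

text \<open>One generation step, by splitting off the first family, which is independent of the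
  others. The parents carry independent marks, and given these each marked parent contributes an
  independent \<open>g\<close>-distributed number of surviving children.\<close>

lemma grp_law:
  assumes thin: "thin p \<sigma> = zmix u g" and g: "\<And>k. k \<in> set_pmf g \<Longrightarrow> 0 < k"
  shows "do {cs \<leftarrow> replicate_pmf z p; al \<leftarrow> replicate_pmf (sum_list cs) (bernoulli_pmf \<sigma>);
             return_pmf (grp cs al, count_true al)}
       = do {al \<leftarrow> replicate_pmf z (bernoulli_pmf u); xs \<leftarrow> replicate_pmf (count_true al) g;
             return_pmf (al, sum_list xs)}"
    (is "?L z = ?R z")
proof (induction z)
  case 0
  show ?case
    by (simp add: bind_return_pmf)
next
  case (Suc z)
  let ?J = "do {c \<leftarrow> p; al \<leftarrow> replicate_pmf c (bernoulli_pmf \<sigma>); return_pmf (True \<in> set al, count_true al)}"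
  have split_rep: "do {al \<leftarrow> replicate_pmf (c + n) (bernoulli_pmf \<sigma>); F al}
      = do {al1 \<leftarrow> replicate_pmf c (bernoulli_pmf \<sigma>); al2 \<leftarrow> replicate_pmf n (bernoulli_pmf \<sigma>); F (al1 @ al2)}"
    for c n and F :: "bool list \<Rightarrow> (bool list \<times> nat) pmf"
    by (simp add: replicate_pmf_distrib bind_assoc_pmf bind_return_pmf)
  have "?L (Suc z) = do {c \<leftarrow> p; cs \<leftarrow> replicate_pmf z p;
      al1 \<leftarrow> replicate_pmf c (bernoulli_pmf \<sigma>); al2 \<leftarrow> replicate_pmf (sum_list cs) (bernoulli_pmf \<sigma>);
      return_pmf (grp (c # cs) (al1 @ al2), count_true (al1 @ al2))}"
    by (simp add: bind_assoc_pmf bind_return_pmf split_rep del: grp.simps count_true_simps)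
  also have "\<dots> = do {c \<leftarrow> p; cs \<leftarrow> replicate_pmf z p;
      al1 \<leftarrow> replicate_pmf c (bernoulli_pmf \<sigma>); al2 \<leftarrow> replicate_pmf (sum_list cs) (bernoulli_pmf \<sigma>);
      return_pmf ((True \<in> set al1) # grp cs al2, count_true al1 + count_true al2)}"
    by (intro bind_pmf_cong refl) (auto simp: set_replicate_pmf)
  \<comment> \<open>By independence the marks of the first family may be drawn before the sizes of
    the other families; this isolates the factor \<open>?J\<close>.\<close>
  also have "\<dots> = do {c \<leftarrow> p; al1 \<leftarrow> replicate_pmf c (bernoulli_pmf \<sigma>); cs \<leftarrow> replicate_pmf z p;
      al2 \<leftarrow> replicate_pmf (sum_list cs) (bernoulli_pmf \<sigma>);
      return_pmf ((True \<in> set al1) # grp cs al2, count_true al1 + count_true al2)}"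
    by (intro bind_pmf_cong refl bind_commute_pmf)
  also have "\<dots> = do {(b, k) \<leftarrow> ?J; (x, s) \<leftarrow> ?L z; return_pmf (b # x, k + s)}"
    by (simp add: bind_assoc_pmf bind_return_pmf)
  also have "\<dots> = do {(b, k) \<leftarrow> do {b \<leftarrow> bernoulli_pmf u; k \<leftarrow> if b then g else return_pmf 0; return_pmf (b, k)};
      (x, s) \<leftarrow> ?R z; return_pmf (b # x, k + s)}"
    unfolding Suc by (subst thin_alive_count[OF thin]) (auto dest: g)
  also have "\<dots> = do {b \<leftarrow> bernoulli_pmf u; k \<leftarrow> if b then g else return_pmf 0;
      al \<leftarrow> replicate_pmf z (bernoulli_pmf u); xs \<leftarrow> replicate_pmf (count_true al) g;
      return_pmf (b # al, k + sum_list xs)}"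
    by (simp add: bind_assoc_pmf bind_return_pmf)
  also have "\<dots> = do {b \<leftarrow> bernoulli_pmf u; al \<leftarrow> replicate_pmf z (bernoulli_pmf u); 
      k \<leftarrow> if b then g else return_pmf 0; xs \<leftarrow> replicate_pmf (count_true al) g;
      return_pmf (b # al, k + sum_list xs)}"
    by (intro bind_pmf_cong refl bind_commute_pmf)
  also have "\<dots> = do {b \<leftarrow> bernoulli_pmf u; al \<leftarrow> replicate_pmf z (bernoulli_pmf u); 
      xs \<leftarrow> replicate_pmf (count_true (b # al)) g; return_pmf (b # al, sum_list xs)}"
    by (intro bind_pmf_cong refl) (auto simp: bind_assoc_pmf bind_return_pmf)
  also have "\<dots> = ?R (Suc z)"
    by (simp add: bind_assoc_pmf bind_return_pmf)
  finally show ?case .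
qed

lemma set_geoms_pos: "g \<in> set (geoms l) \<Longrightarrow> k \<in> set_pmf g \<Longrightarrow> 0 < k"
  by (induction l) (auto dest: set_pmf_geom_plus)

abbreviation LFs :: "(real \<times> real) list \<Rightarrow> nat pmf list" where
  "LFs l \<equiv> map (\<lambda>x. LF (fst x) (snd x)) l"

text \<open>The marks are carried along for the sake of the induction: given the marks of a
  generation, the counts depend on them only through \<open>count_true\<close>. The induction
  hypothesis supplies the marks of the children, and \<open>grp_law\<close> turns them into marks of
  the parents.\<close>

lemma alive_cnt_law:
  assumes "\<And>x. x \<in> set l \<Longrightarrow> admissible x"
  shows "map_pmf (\<lambda>T. (alive z T, cnt z T)) (gw_tree z (LFs l))
       = do {al \<leftarrow> replicate_pmf z (bernoulli_pmf (1 / isv l)); c \<leftarrow> gw_counts (count_true al) (geoms l);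
             return_pmf (al, c)}"
  using assms
proof (induction l arbitrary: z)
  case Nil
  have "bernoulli_pmf 1 = return_pmf True"
    by (rule pmf_eqI) (auto split: split_indicator)
  then have "replicate_pmf z (bernoulli_pmf 1) = return_pmf (replicate z True)"
    by (induction z) (auto simp: bind_return_pmf)
  then show ?case
    by (simp add: bind_return_pmf)
next
  case (Cons x l)
  let ?p = "LF (fst x) (snd x)" and ?\<sigma> = "1 / isv l" and ?u = "1 / isv (x # l)"
  let ?g = "geom_plus (fst x * isv l / isv (x # l))"
  let ?F = "\<lambda>y s. do {c \<leftarrow> gw_counts s (geoms l); return_pmf (y, count_true y # c)}"
  have thin: "thin ?p ?\<sigma> = zmix ?u ?g"
    using Cons.prems isv_ge_1[of l] by (simp add: thin_LF admissible_def)
  have "map_pmf (\<lambda>T. (alive z T, cnt z T)) (gw_tree z (LFs (x # l)))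
      = do {cs \<leftarrow> replicate_pmf z ?p; T \<leftarrow> gw_tree (sum_list cs) (LFs l);
            return_pmf (alive z (cs # T), cnt z (cs # T))}"
    by (simp add: map_bind_pmf bind_return_pmf del: alive.simps cnt.simps)
  also have "\<dots> = do {cs \<leftarrow> replicate_pmf z ?p; T \<leftarrow> gw_tree (sum_list cs) (LFs l);
      return_pmf (grp cs (alive (sum_list cs) T), count_true (grp cs (alive (sum_list cs) T)) # cnt (sum_list cs) T)}"
    by (intro bind_pmf_cong refl)
       (auto simp: set_replicate_pmf alive_Cons_grp gw_tree_support simp del: alive.simps)
  also have "\<dots> = do {cs \<leftarrow> replicate_pmf z ?p;
      (al, c) \<leftarrow> map_pmf (\<lambda>T. (alive (sum_list cs) T, cnt (sum_list cs) T)) (gw_tree (sum_list cs) (LFs l));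
      return_pmf (grp cs al, count_true (grp cs al) # c)}"
    by (simp add: bind_map_pmf)
  also have "\<dots> = do {(y, s) \<leftarrow> do {cs \<leftarrow> replicate_pmf z ?p;
        al \<leftarrow> replicate_pmf (sum_list cs) (bernoulli_pmf ?\<sigma>); return_pmf (grp cs al, count_true al)};
      ?F y s}"
    using Cons by (simp add: bind_assoc_pmf bind_return_pmf)
  also have "\<dots> = do {(y, s) \<leftarrow> do {al \<leftarrow> replicate_pmf z (bernoulli_pmf ?u);
        xs \<leftarrow> replicate_pmf (count_true al) ?g; return_pmf (al, sum_list xs)};
      ?F y s}"
    by (subst grp_law[OF thin]) (auto dest: set_pmf_geom_plus)
  also have "\<dots> = do {al \<leftarrow> replicate_pmf z (bernoulli_pmf ?u); c \<leftarrow> gw_counts (count_true al) (geoms (x # l));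
      return_pmf (al, c)}"
    by (simp add: bind_assoc_pmf bind_return_pmf)
  finally show ?case .
qed

lemma cnt_law:
  assumes "\<And>x. x \<in> set l \<Longrightarrow> admissible x"
  shows "map_pmf (cnt 1) (gw_tree 1 (LFs l))
       = do {b \<leftarrow> bernoulli_pmf (1 / isv l); gw_counts (if b then 1 else 0) (geoms l)}"
proof -
  have "map_pmf (cnt 1) (gw_tree 1 (LFs l))
      = map_pmf snd (map_pmf (\<lambda>T. (alive 1 T, cnt 1 T)) (gw_tree 1 (LFs l)))"
    by (simp add: pmf.map_comp o_def)
  also have "\<dots> = do {b \<leftarrow> bernoulli_pmf (1 / isv l); gw_counts (if b then 1 else 0) (geoms l)}"
    by (subst alive_cnt_law[OF assms])
       (auto simp: map_bind_pmf bind_assoc_pmf bind_return_pmf bind_return_pmf' intro!: bind_pmf_cong)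
  finally show ?thesis .
qed

text \<open>Positive offspring numbers prevent extinction, and nothing arises from zero
  individuals.\<close>

lemma gw_counts_last:
  assumes "c \<in> set_pmf (gw_counts z gs)" "\<And>g k. g \<in> set gs \<Longrightarrow> k \<in> set_pmf g \<Longrightarrow> 0 < k"
  shows "c \<noteq> [] \<and> (0 < last c \<longleftrightarrow> 0 < z)"
  using assms
proof (induction gs arbitrary: c z)
  case (Cons g gs)
  then obtain xs c' where *: "xs \<in> set_pmf (replicate_pmf z g)" "c' \<in> set_pmf (gw_counts (sum_list xs) gs)"
    "c = z # c'"
    by auto
  then have "c' \<noteq> []" "0 < last c' \<longleftrightarrow> 0 < sum_list xs"
    using Cons.IH[of c' "sum_list xs"] Cons.prems by auto
  moreover have "0 < sum_list xs \<longleftrightarrow> 0 < z"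
    using *(1) Cons.prems(2)[of g] by (cases xs) (auto simp: set_replicate_pmf)
  ultimately show ?case
    using * by simp
qed auto

section \<open>Conditioning on survival\<close>

lemma measure_bind_bernoulli:
  assumes "0 \<le> u" "u \<le> 1"
  shows "measure_pmf.prob (bind_pmf (bernoulli_pmf u) K) A
       = u * measure_pmf.prob (K True) A + (1 - u) * measure_pmf.prob (K False) A"
proof -
  have "measure_pmf.prob (bind_pmf (bernoulli_pmf u) K) A
      = measure_pmf.expectation (bind_pmf (bernoulli_pmf u) K) (indicator A)"
    by simp
  also have "\<dots> = measure_pmf.expectation (bernoulli_pmf u) (\<lambda>b. measure_pmf.expectation (K b) (indicator A))"
    by (rule expectation_bind_pmf[where B = 1]) (auto split: split_indicator)
  finally show ?thesis
    using assms by simp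
qed

text \<open>The last reduced count is the size of generation \<open>n\<close>, and it is positive
  exactly when the ancestor is marked. Conditioning therefore sets the initial coin to
  \<open>True\<close>, and the factor \<open>1 / isv l\<close> cancels.\<close>

lemma qcond_cnt:
  assumes l: "\<And>x. x \<in> set l \<Longrightarrow> admissible x" and n: "n = length l"
  shows "qcond_prob (gw_tree 1 (LFs l)) {T. cnt 1 T \<in> S} {T. gen_size T n > 0}
       = measure_pmf.prob (gw_counts 1 (geoms l)) S"
proof -
  let ?\<sigma> = "1 / isv l"
  have \<sigma>: "0 < ?\<sigma>" "0 \<le> ?\<sigma>" "?\<sigma> \<le> 1"
    using isv_ge_1[of l, OF l] by auto
  have eq: "measure_pmf.prob (gw_tree 1 (LFs l)) ({T. cnt 1 T \<in> S'} \<inter> {T. gen_size T n > 0})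
      = ?\<sigma> * measure_pmf.prob (gw_counts 1 (geoms l)) S'" for S'
  proof -
    have "measure_pmf.prob (gw_tree 1 (LFs l)) ({T. cnt 1 T \<in> S'} \<inter> {T. gen_size T n > 0})
        = measure_pmf.prob (gw_tree 1 (LFs l)) (cnt 1 -` (S' \<inter> {c. 0 < last c}))"
      by (rule measure_pmf.finite_measure_eq_AE)
         (auto simp: AE_measure_pmf_iff n gen_size_eq_last_cnt[symmetric, simplified] dest!: gw_tree_support)
    also have "\<dots> = measure_pmf.prob (map_pmf (cnt 1) (gw_tree 1 (LFs l))) (S' \<inter> {c. 0 < last c})"
      by simp
    also have "\<dots> = ?\<sigma> * measure_pmf.prob (gw_counts 1 (geoms l)) (S' \<inter> {c. 0 < last c})
        + (1 - ?\<sigma>) * measure_pmf.prob (gw_counts 0 (geoms l)) (S' \<inter> {c. 0 < last c})"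
      using \<sigma> by (subst cnt_law[OF l]) (auto simp: measure_bind_bernoulli)
    also have "measure_pmf.prob (gw_counts 1 (geoms l)) (S' \<inter> {c. 0 < last c})
        = measure_pmf.prob (gw_counts 1 (geoms l)) S'"
      by (rule measure_pmf.finite_measure_eq_AE)
         (auto simp: AE_measure_pmf_iff dest!: gw_counts_last[OF _ set_geoms_pos])
    also have "measure_pmf.prob (gw_counts 0 (geoms l)) (S' \<inter> {c. 0 < last c}) = 0"
      by (auto simp: measure_pmf_zero_iff dest!: gw_counts_last[OF _ set_geoms_pos])
    finally show ?thesis
      by simp
  qed
  show ?thesis
    \<comment> \<open>The set \<open>S\<close> gives the numerator, \<open>UNIV\<close> the
      denominator.\<close>
    unfolding qcond_prob_def using eq[of S] eq[of UNIV] \<sigma> by simp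
qed

text \<open>Absorbing one generation keeps the initial law geometric, by
  \<open>geom_plus_compose\<close>; the arbitrary \<open>q\<close> lets the induction run. In the
  product of the parameters the values of \<open>isv\<close> telescope.\<close>

lemma drop_gw_counts_geom:
  assumes "\<And>x. x \<in> set l \<Longrightarrow> admissible x" "0 < q" "q \<le> 1" "j \<le> length l"
  shows "map_pmf (drop j) (bind_pmf (geom_plus q) (\<lambda>z. gw_counts z (geoms l)))
       = bind_pmf (geom_plus (q * (prod_list (map fst (take j l)) * isv (drop j l) / isv l)))
           (\<lambda>z. gw_counts z (geoms (drop j l)))"
  using assms
proof (induction j arbitrary: q l)
  case 0
  then show ?case
    using isv_ge_1[of l] by (simp add: map_pmf_ident drop_0 flip: map_pmf_def)
next
  case (Suc j)
  then obtain x l' where l: "l = x # l'"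
    by (cases l) auto
  define g where "g = fst x * isv l' / isv l"
  have g: "0 < g" "g \<le> 1"
    using geom_param_bounds[of x l'] Suc.prems by (auto simp: g_def l)
  have pos: "0 < isv l'"
    using isv_ge_1[of l'] Suc.prems(1) l by fastforce
  have "map_pmf (drop (Suc j)) (bind_pmf (geom_plus q) (\<lambda>z. gw_counts z (geoms l)))
      = map_pmf (drop j) (bind_pmf (bind_pmf (geom_plus q) (\<lambda>z. map_pmf sum_list (replicate_pmf z (geom_plus g))))
          (\<lambda>z. gw_counts z (geoms l')))"
    by (simp add: l g_def map_bind_pmf bind_assoc_pmf bind_map_pmf bind_return_pmf map_pmf_def)
  also have "\<dots> = map_pmf (drop j) (bind_pmf (geom_plus (q * g)) (\<lambda>z. gw_counts z (geoms l')))"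
    using Suc.prems g by (simp add: geom_plus_compose)
  also have "\<dots> = bind_pmf (geom_plus (q * g * (prod_list (map fst (take j l')) * isv (drop j l') / isv l')))
           (\<lambda>z. gw_counts z (geoms (drop j l')))"
    using Suc.prems g by (intro Suc.IH) (auto simp: l mult_le_one)
  also have "q * g * (prod_list (map fst (take j l')) * isv (drop j l') / isv l')
      = q * (prod_list (map fst (take (Suc j) l)) * isv (drop (Suc j) l) / isv l)"
    using pos by (simp add: g_def l)
  finally show ?case
    by (simp add: l)
qed

lemma qcond_drop_cnt:
  assumes l: "\<And>x. x \<in> set l \<Longrightarrow> admissible x" and n: "n = length l" and j: "j \<le> n"
  shows "qcond_prob (gw_tree 1 (LFs l)) {T. drop j (cnt 1 T) \<in> S} {T. gen_size T n > 0}
       = measure_pmf.prob (bind_pmf (geom_plus (prod_list (map fst (take j l)) * isv (drop j l) / isv l))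
           (\<lambda>z. gw_counts z (geoms (drop j l)))) S"
proof -
  \<comment> \<open>A single ancestor is the degenerate geometric law, so the previous lemma applies
    with \<open>q = 1\<close>.\<close>
  have "geom_plus 1 = return_pmf 1"
    by (simp add: geom_plus_def)
  then have "map_pmf (drop j) (gw_counts 1 (geoms l))
      = bind_pmf (geom_plus (prod_list (map fst (take j l)) * isv (drop j l) / isv l))
           (\<lambda>z. gw_counts z (geoms (drop j l)))"
    using drop_gw_counts_geom[of l 1 j] l n j by (simp add: bind_return_pmf)
  moreover have "qcond_prob (gw_tree 1 (LFs l)) {T. drop j (cnt 1 T) \<in> S} {T. gen_size T n > 0}
      = measure_pmf.prob (map_pmf (drop j) (gw_counts 1 (geoms l))) S"
    using qcond_cnt[OF l n, of "drop j -` S"] by simp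
  ultimately show ?thesis
    by simp
qed

section \<open>Deterministic environments\<close>

lemma prob_bind_pmf:
  "measure_pmf.prob (bind_pmf p K) S = measure_pmf.expectation p (\<lambda>x. measure_pmf.prob (K x) S)"
proof -
  have "measure_pmf.prob (bind_pmf p K) S = measure_pmf.expectation (bind_pmf p K) (indicator S)"
    by simp
  also have "\<dots> = measure_pmf.expectation p (\<lambda>x. measure_pmf.expectation (K x) (indicator S))"
    by (rule expectation_bind_pmf[where B = 1]) (auto split: split_indicator)
  finally show ?thesis
    by simp
qed

lemma prob_geom_plus_gt_1:
  assumes "0 < q" "q \<le> 1"
  shows "measure_pmf.prob (geom_plus q) {k. 1 < k} = 1 - q"
proof -
  have "measure_pmf.prob (geom_plus q) {k. 1 < k} = measure_pmf.prob (geometric_pmf q) (- {0})"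
    unfolding geom_plus_def measure_map_pmf by (rule arg_cong[where f = "measure_pmf.prob _"]) auto
  also have "\<dots> = 1 - q"
    using assms measure_pmf.prob_compl[of "{0}" "geometric_pmf q"] 
    by (simp add: Compl_eq_Diff_UNIV measure_pmf_single)
  finally show ?thesis .
qed

text \<open>A variable of law \<open>geom_plus (r * q)\<close> is a \<open>geom_plus r\<close>-distributed sum of variables of
  law \<open>geom_plus q\<close>, and this sum has exactly one term with probability \<open>r\<close>.\<close>

lemma geom_plus_bind_close:
  assumes "0 < r" "r \<le> 1" "0 < q" "q \<le> 1"
  shows "\<bar>measure_pmf.prob (bind_pmf (geom_plus q) K) S
          - measure_pmf.prob (bind_pmf (geom_plus (r * q)) K) S\<bar> \<le> 1 - r"
proof -
  define h where "h z = measure_pmf.prob (bind_pmf (map_pmf sum_list (replicate_pmf z (geom_plus q))) K) S" for z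
  have h: "0 \<le> h z" "h z \<le> 1" for z
    by (auto simp: h_def)
  have int: "integrable (measure_pmf (geom_plus r)) (\<lambda>z. h z - h 1)"
    by (rule measure_pmf.integrable_const_bound[where B = 1])
       (use h[of 1] h in \<open>auto simp: abs_le_iff diff_le_eq intro!: AE_I2 add_increasing2\<close>)
  have eq: "measure_pmf.prob (bind_pmf (geom_plus (r * q)) K) S = measure_pmf.expectation (geom_plus r) h"
    using assms by (simp add: geom_plus_compose[symmetric] bind_assoc_pmf prob_bind_pmf[of "geom_plus r"] h_def[abs_def])
  have int_h: "integrable (measure_pmf (geom_plus r)) h"
    by (rule measure_pmf.integrable_const_bound[where B = 1]) (use h in auto)
  have "h 1 = measure_pmf.prob (bind_pmf (geom_plus q) K) S"
    unfolding h_def replicate_pmf_1 by (simp add: pmf.map_comp o_def)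
  then have "\<bar>measure_pmf.prob (bind_pmf (geom_plus q) K) S
          - measure_pmf.prob (bind_pmf (geom_plus (r * q)) K) S\<bar>
      = \<bar>measure_pmf.expectation (geom_plus r) (\<lambda>z. h z - h 1)\<bar>"
    using int_h by (simp add: eq abs_minus_commute)
  also have "\<dots> \<le> measure_pmf.expectation (geom_plus r) (\<lambda>z. \<bar>h z - h 1\<bar>)"
    by (rule integral_abs_bound)
  \<comment> \<open>The difference vanishes at \<open>z = 1\<close> and is at most 1
    elsewhere.\<close>
  also have "\<dots> \<le> measure_pmf.expectation (geom_plus r) (indicator {k. 1 < k})"
  proof (rule integral_mono_AE)
    show "AE z in measure_pmf (geom_plus r). \<bar>h z - h 1\<bar> \<le> indicator {k. 1 < k} z"
    proof (unfold AE_measure_pmf_iff, rule ballI)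
      fix z assume "z \<in> set_pmf (geom_plus r)"
      then have "0 < z"
        by (rule set_pmf_geom_plus)
      then show "\<bar>h z - h 1\<bar> \<le> indicator {k. 1 < k} z"
        using h[of z] h[of 1] by (cases "z = 1") (auto simp: indicator_def abs_le_iff)
    qed
    show "integrable (measure_pmf (geom_plus r)) (indicator {k. 1 < k} :: nat \<Rightarrow> real)"
      by (rule measure_pmf.integrable_const_bound[where B = 1]) auto
  qed (use int in auto)
  also have "\<dots> = 1 - r"
    using prob_geom_plus_gt_1[OF assms(1,2)] by simp
  finally show ?thesis .
qed

lemma qcond_prob_cong:
  assumes "\<And>T. T \<in> set_pmf p \<Longrightarrow> T \<in> S \<longleftrightarrow> T \<in> S'"
  shows "qcond_prob p S C = qcond_prob p S' C"
proof -
  have "measure_pmf.prob p (S \<inter> C) = measure_pmf.prob p (S' \<inter> C)"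
    by (rule measure_pmf.finite_measure_eq_AE) (use assms in \<open>auto simp: AE_measure_pmf_iff\<close>)
  then show ?thesis
    by (simp add: qcond_prob_def)
qed

text \<open>If \<open>C\<close> has probability 0, the quotient is 0 by the convention for division,
  so the bounds are unconditional.\<close>

lemma qcond_prob_bounds: "0 \<le> qcond_prob p S C" "qcond_prob p S C \<le> 1"
proof -
  have "measure_pmf.prob p (S \<inter> C) \<le> measure_pmf.prob p C"
    by (intro measure_pmf.finite_measure_mono) auto
  then show "0 \<le> qcond_prob p S C" "qcond_prob p S C \<le> 1"
    by (auto simp: qcond_prob_def divide_le_eq_1 zero_less_measure_iff)
qed

lemma map_hd_gw_counts: "map_pmf hd (gw_counts z gs) = return_pmf z"
  by (cases gs) (auto simp: map_bind_pmf)

text \<open>The induction runs on a division-free inequality: after multiplication by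
  \<open>fst x\<close>, the bound for \<open>l'\<close> gains the positive term
  \<open>snd x\<close>.\<close>

lemma gt1_param_bounds:
  assumes "\<And>x. x \<in> set l \<Longrightarrow> admissible x" "m \<le> length l"
  shows "0 < prod_list (map fst (take m l)) * isv (drop m l) / isv l"
    "prod_list (map fst (take m l)) * isv (drop m l) / isv l \<le> 1"
proof -
  have *: "0 < prod_list (map fst (take m l)) * isv (drop m l) \<and>
        prod_list (map fst (take m l)) * isv (drop m l) \<le> isv l"
    using assms
  proof (induction m arbitrary: l)
    case 0
    then show ?case
      using isv_ge_1[of l] by simp
  next
    case (Suc m)
    then obtain x l' where l: "l = x # l'"
      by (cases l) auto
    have x: "0 < fst x" "0 < snd x"
      using Suc.prems by (auto simp: l admissible_def)
    define P where "P = prod_list (map fst (take m l')) * isv (drop m l')"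
    have P: "0 < P" "P \<le> isv l'"
      using Suc.IH[of l'] Suc.prems by (auto simp: P_def l)
    then have "fst x * P \<le> fst x * isv l'"
      using x by (intro mult_left_mono) auto
    then have "fst x * P \<le> isv l"
      using x unfolding l isv.simps by linarith
    moreover have "0 < fst x * P"
      using x P by simp
    ultimately
    show ?case
      by (simp add: l P_def mult.assoc)
  qed
  moreover have "1 \<le> isv l"
    using assms isv_ge_1 by blast
  ultimately show "0 < prod_list (map fst (take m l)) * isv (drop m l) / isv l"
    "prod_list (map fst (take m l)) * isv (drop m l) / isv l \<le> 1"
    by (auto simp: divide_le_eq_1)
qed

text \<open>\<open>Zred T m\<close> is the head of the remaining list of counts, so its conditional
  law is the geometric initial law of that list.\<close>

lemma qcond_Zred_gt_1:
  assumes l: "\<And>x. x \<in> set l \<Longrightarrow> admissible x" and n: "n = length l" and m: "m \<le> n"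
  shows "qcond_prob (gw_tree 1 (LFs l)) {T. Zred T m > 1} {T. gen_size T n > 0}
       = 1 - prod_list (map fst (take m l)) * isv (drop m l) / isv l"
proof -
  let ?q = "prod_list (map fst (take m l)) * isv (drop m l) / isv l"
  have "qcond_prob (gw_tree 1 (LFs l)) {T. Zred T m > 1} {T. gen_size T n > 0}
      = qcond_prob (gw_tree 1 (LFs l)) {T. drop m (cnt 1 T) \<in> {c. 1 < hd c}} {T. gen_size T n > 0}"
    by (rule qcond_prob_cong)
       (use m in \<open>auto simp: n Zred_eq_cnt hd_drop_conv_nth dest!: gw_tree_support\<close>)
  also have "\<dots> = measure_pmf.prob (bind_pmf (geom_plus ?q) (\<lambda>z. gw_counts z (geoms (drop m l)))) {c. 1 < hd c}"
    by (rule qcond_drop_cnt[OF l n m])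
  also have "\<dots> = measure_pmf.prob (map_pmf hd (bind_pmf (geom_plus ?q) (\<lambda>z. gw_counts z (geoms (drop m l))))) {k. 1 < k}"
    by (simp add: vimage_def)
  also have "map_pmf hd (bind_pmf (geom_plus ?q) (\<lambda>z. gw_counts z (geoms (drop m l)))) = geom_plus ?q"
    by (simp add: map_bind_pmf map_hd_gw_counts bind_return_pmf')
  also have "measure_pmf.prob (geom_plus ?q) {k. 1 < k} = 1 - ?q"
    using gt1_param_bounds[of l m] l m n by (intro prob_geom_plus_gt_1) auto
  finally show ?thesis .
qed

section \<open>Parameters of the reduced process in terms of \<open>Pi_env\<close>,
  \<open>R_env\<close> and \<open>Rinv_env\<close>\<close>

definition good_env :: "env \<Rightarrow> bool" where
  "good_env e \<longleftrightarrow> (\<forall>k\<ge>1. admissible (e k))"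

lemma good_envD: "good_env e \<Longrightarrow> 1 \<le> k \<Longrightarrow> 0 < fst (e k)" "good_env e \<Longrightarrow> 1 \<le> k \<Longrightarrow> 0 < snd (e k)"
  by (auto simp: good_env_def admissible_def)

lemma Pi_env_pos: "good_env e \<Longrightarrow> 0 < Pi_env e n"
  unfolding Pi_env_def by (intro prod_pos) (auto dest: good_envD)

lemma Pi_env_Suc [simp]: "Pi_env e (Suc n) = Pi_env e n * fst (e (Suc n))"
  by (simp add: Pi_env_def)

lemma R_env_Suc [simp]: "R_env e (Suc n) = R_env e n + Pi_env e n * snd (e (Suc n))"
  by (simp add: R_env_def)

lemma Rinv_env_Suc [simp]: "Rinv_env e (Suc n) = Rinv_env e n + snd (e (Suc n)) / Pi_env e (Suc n)"
  by (simp add: Rinv_env_def)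

lemma env_0 [simp]: "Pi_env e 0 = 1" "R_env e 0 = 0" "Rinv_env e 0 = 0"
  by (simp_all add: Pi_env_def R_env_def Rinv_env_def)

lemma incseq_Rinv_env: "good_env e \<Longrightarrow> incseq (Rinv_env e)"
  by (rule incseq_SucI) (auto simp: Pi_env_pos good_envD less_imp_le simp del: Pi_env_Suc)

lemma Rinv_env_nonneg: "good_env e \<Longrightarrow> 0 \<le> Rinv_env e n"
  using incseqD[OF incseq_Rinv_env, of e 0 n] by simp

lemma incseq_R_env: "good_env e \<Longrightarrow> incseq (R_env e)"
  by (rule incseq_SucI) (auto simp: Pi_env_pos good_envD less_imp_le simp del: Pi_env_Suc)

lemma R_env_nonneg: "good_env e \<Longrightarrow> 0 \<le> R_env e n"
  using incseqD[OF incseq_R_env, of e 0 n] by simp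

text \<open>Backward induction on \<open>m\<close>: prefixing the environment of index
  \<open>Suc m\<close> adds \<open>Pi_env e m * snd (e (Suc m))\<close>, the increment of
  \<open>R_env\<close>. For \<open>m = 0\<close> this is the reciprocal of the survival
  probability.\<close>

lemma Pi_env_mult_isv:
  "m \<le> n \<Longrightarrow> Pi_env e m * isv (map e [Suc m..<Suc n]) = Pi_env e n + R_env e n - R_env e m"
proof (induction rule: inc_induct)
  case (step m)
  have "[Suc m..<Suc n] = Suc m # [Suc (Suc m)..<Suc n]"
    using step by (simp add: upt_conv_Cons del: upt_Suc)
  then show ?case
    using step.IH by (simp add: algebra_simps del: upt_Suc)
qed simp

lemma rev_upt_Suc: "rev [1..<Suc (Suc m)] = Suc m # rev [1..<Suc m]"
  by simp

text \<open>In reversed order the newest environment comes first. Factoring out the new product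
  \<open>Pi_env e (Suc m)\<close> leaves exactly the next term of \<open>Rinv_env\<close>.\<close>

lemma isv_rev_env:
  assumes "good_env e"
  shows "isv (map e (rev [1..<Suc m])) = Pi_env e m * (1 + Rinv_env e m)"
proof (induction m)
  case (Suc m)
  have "Pi_env e (Suc m) \<noteq> 0"
    using Pi_env_pos[OF assms, of "Suc m"] by linarith
  then show ?case
    using Suc unfolding rev_upt_Suc by (simp add: field_simps del: upt_Suc)
qed simp

text \<open>The products \<open>Pi_env\<close> cancel in ratios of consecutive values of
  \<open>isv\<close>. The result is the list of offspring laws in \<open>Zstar_law\<close>; it
  involves only the first \<open>m\<close> environments.\<close>

lemma geoms_rev_env:
  assumes "good_env e"
  shows "geoms (map e (rev [1..<Suc m]))
       = map (\<lambda>k. geom_plus ((1 + Rinv_env e (m - k - 1)) / (1 + Rinv_env e (m - k)))) [0..<m]"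
proof (induction m)
  case (Suc m)
  have "fst (e (Suc m)) * isv (map e (rev [1..<Suc m])) / isv (map e (rev [1..<Suc (Suc m)]))
      = (1 + Rinv_env e m) / (1 + Rinv_env e (Suc m))"
    using Pi_env_pos[OF assms, of m] good_envD(1)[OF assms, of "Suc m"]
    by (simp only: isv_rev_env[OF assms] Pi_env_Suc) simp
  moreover have "[0..<Suc m] = 0 # map Suc [0..<m]"
    by (simp add: upt_conv_Cons map_Suc_upt del: upt_Suc)
  ultimately show ?case
    using Suc unfolding rev_upt_Suc by (simp del: upt_Suc Rinv_env_Suc isv.simps add: o_def flip: rev_upt_Suc[simplified])
qed simp

lemma prod_list_env:
  assumes "m \<le> n"
  shows "Pi_env e m * prod_list (map (\<lambda>k. fst (e k)) [Suc m..<Suc n]) = Pi_env e n"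
  using assms by (induction n rule: dec_induct) (auto simp: mult.assoc)

lemma admissible_env:
  "good_env e \<Longrightarrow> x \<in> set (map e [1..<Suc n]) \<Longrightarrow> admissible x"
  "good_env e \<Longrightarrow> x \<in> set (map e (rev [1..<Suc n])) \<Longrightarrow> admissible x"
  by (auto simp: good_env_def simp del: upt_Suc)

lemma tree_fwd_LFs: "tree_fwd e n = gw_tree 1 (LFs (map e [1..<Suc n]))"
  by (simp add: tree_fwd_def o_def del: upt_Suc)

lemma tree_rev_LFs: "tree_rev e n = gw_tree 1 (LFs (map e (rev [1..<Suc n])))"
  by (simp add: tree_rev_def o_def del: upt_Suc)

text \<open>The geometric parameter is \<open>(Pi_env e n + R_env e n - R_env e m) / (Pi_env e n +
  R_env e n)\<close>, from \<open>Pi_env_mult_isv\<close> at \<open>m\<close> and at 0.\<close>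

lemma qcond_tree_fwd:
  assumes e: "good_env e" and "m \<le> n"
  shows "qcond_prob (tree_fwd e n) {T. Zred T m > 1} {T. gen_size T n > 0}
       = R_env e m / (Pi_env e n + R_env e n)"
proof -
  let ?l = "map e [1..<Suc n]"
  have take: "take m ?l = map e [1..<Suc m]" "drop m ?l = map e [Suc m..<Suc n]"
    using \<open>m \<le> n\<close> by (auto simp: take_map drop_map take_upt drop_upt simp del: upt_Suc)
  have "prod_list (map fst (take m ?l)) = Pi_env e m"
    using prod_list_env[of 0 m e] unfolding take by (simp add: o_def del: upt_Suc)
  then have num: "prod_list (map fst (take m ?l)) * isv (drop m ?l) = Pi_env e n + R_env e n - R_env e m"
    using Pi_env_mult_isv[OF \<open>m \<le> n\<close>, of e] unfolding take by (simp only:)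
  have den: "isv ?l = Pi_env e n + R_env e n"
    using Pi_env_mult_isv[of 0 n e] by (simp del: upt_Suc)
  have "0 < Pi_env e n + R_env e n"
    using Pi_env_pos[OF e, of n] R_env_nonneg[OF e, of n] by linarith
  moreover have "qcond_prob (tree_fwd e n) {T. Zred T m > 1} {T. gen_size T n > 0}
      = 1 - prod_list (map fst (take m ?l)) * isv (drop m ?l) / isv ?l"
    unfolding tree_fwd_LFs by (rule qcond_Zred_gt_1) (use admissible_env(1)[OF e] \<open>m \<le> n\<close> in auto)
  ultimately show ?thesis
    by (simp only: num den) (simp add: field_simps)
qed

text \<open>The last \<open>m\<close> generations of the reversed environment see \<open>e m\<close>
  down to \<open>e 1\<close>, whatever \<open>n\<close> is. The first components of the preceding
  part complete \<open>Pi_env e m\<close> to \<open>Pi_env e n\<close>, which cancels.\<close>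

lemma rev_env_param:
  assumes e: "good_env e" and "m \<le> n"
  defines "l \<equiv> map e (rev [1..<Suc n])"
  shows "drop (n - m) l = map e (rev [1..<Suc m])"
    and "prod_list (map fst (take (n - m) l)) * isv (drop (n - m) l) / isv l
       = (1 + Rinv_env e m) / (1 + Rinv_env e n)"
proof -
  have take: "take (n - m) l = map e (rev [Suc m..<Suc n])"
    using \<open>m \<le> n\<close> by (auto simp: l_def take_map take_rev drop_upt simp del: upt_Suc)
  show drop: "drop (n - m) l = map e (rev [1..<Suc m])"
    using \<open>m \<le> n\<close> by (auto simp: l_def drop_map drop_rev take_upt simp del: upt_Suc)
  have Pi: "Pi_env e m * prod_list (map fst (take (n - m) l)) = Pi_env e n"
    using prod_list_env[OF \<open>m \<le> n\<close>, of e] by (simp add: take o_def rev_map[symmetric] prod_list.rev del: upt_Suc)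
  have "isv (drop (n - m) l) = Pi_env e m * (1 + Rinv_env e m)"
    unfolding drop by (rule isv_rev_env[OF e])
  then have "prod_list (map fst (take (n - m) l)) * isv (drop (n - m) l) = Pi_env e n * (1 + Rinv_env e m)"
    by (simp only: Pi[symmetric] mult_ac)
  moreover have "isv l = Pi_env e n * (1 + Rinv_env e n)"
    unfolding l_def by (rule isv_rev_env[OF e])
  ultimately show "prod_list (map fst (take (n - m) l)) * isv (drop (n - m) l) / isv l
       = (1 + Rinv_env e m) / (1 + Rinv_env e n)"
    using Pi_env_pos[OF e, of n] by simp
qed

section \<open>Quenched limits in the reversed environment\<close>

lemma qcond_tree_rev:
  assumes e: "good_env e" and "m \<le> n"
  shows "qcond_prob (tree_rev e n) {T. Zred T m > 1} {T. gen_size T n > 0}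
       = 1 - (1 + Rinv_env e (n - m)) / (1 + Rinv_env e n)"
  unfolding tree_rev_LFs
  using admissible_env(2)[OF e] rev_env_param(2)[OF e, of "n - m" n] \<open>m \<le> n\<close>
  by (subst qcond_Zred_gt_1) (auto simp del: upt_Suc set_map set_upt set_rev)

text \<open>\<open>Rinv_env e (n - ms n)\<close> and \<open>Rinv_env e n\<close> have the same
  finite limit, so their quotient after adding 1 tends to 1.\<close>

lemma tendsto_qcond_tree_rev:
  assumes e: "good_env e" and conv: "convergent (Rinv_env e)"
    and ms: "\<And>n. 1 \<le> n \<Longrightarrow> ms n \<le> n" "filterlim (\<lambda>n. n - ms n) at_top sequentially"
  shows "(\<lambda>n. qcond_prob (tree_rev e n) {T. Zred T (ms n) > 1} {T. gen_size T n > 0}) \<longlonglongrightarrow> 0"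
proof -
  have lim: "Rinv_env e \<longlonglongrightarrow> Rinv_inf e"
    using conv by (simp add: Rinv_inf_def convergent_LIMSEQ_iff)
  have "0 \<le> Rinv_inf e"
    using lim by (rule LIMSEQ_le_const) (use Rinv_env_nonneg[OF e] in auto)
  then have "(\<lambda>n. 1 - (1 + Rinv_env e (n - ms n)) / (1 + Rinv_env e n)) \<longlonglongrightarrow> 1 - (1 + Rinv_inf e) / (1 + Rinv_inf e)"
    by (intro tendsto_intros lim filterlim_compose[OF lim ms(2)]) auto
  then have "(\<lambda>n. 1 - (1 + Rinv_env e (n - ms n)) / (1 + Rinv_env e n)) \<longlonglongrightarrow> 0"
    using \<open>0 \<le> Rinv_inf e\<close> by simp
  moreover have "eventually (\<lambda>n. 1 - (1 + Rinv_env e (n - ms n)) / (1 + Rinv_env e n)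
      = qcond_prob (tree_rev e n) {T. Zred T (ms n) > 1} {T. gen_size T n > 0}) sequentially"
    using eventually_ge_at_top[of 1] by eventually_elim (simp add: qcond_tree_rev[OF e] ms del: One_nat_def)
  ultimately show ?thesis
    by (rule Lim_transform_eventually)
qed

text \<open>Both laws run the same kernel \<open>K\<close> from geometric initial laws, with
  parameters \<open>q\<close> and \<open>r n * q = r m\<close>. By
  \<open>geom_plus_bind_close\<close> they differ on every set by at most \<open>1 - r n\<close>,
  which tends to 0.\<close>

lemma tendsto_tv_tree_rev:
  assumes e: "good_env e" and conv: "convergent (Rinv_env e)"
  shows "(\<lambda>n. SUP S :: nat list set.
              \<bar>qcond_prob (tree_rev e n) {T. map (Zred T) [n - m..<Suc n] \<in> S} {T. gen_size T n > 0}
               - measure_pmf.prob (Zstar_law e m) S\<bar>) \<longlonglongrightarrow> 0"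
    (is "(\<lambda>n. SUP S. ?d n S) \<longlonglongrightarrow> 0")
proof -
  have lim: "Rinv_env e \<longlonglongrightarrow> Rinv_inf e"
    using conv by (simp add: Rinv_inf_def convergent_LIMSEQ_iff)
  have le: "Rinv_env e n \<le> Rinv_inf e" for n
    by (rule incseq_le[OF incseq_Rinv_env[OF e] lim])
  have nonneg: "0 \<le> Rinv_env e n" for n
    by (rule Rinv_env_nonneg[OF e])
  have Rinf: "0 \<le> Rinv_inf e"
    using nonneg[of 0] le[of 0] by simp
  define r where "r n = (1 + Rinv_env e n) / (1 + Rinv_inf e)" for n
  have r: "0 < r n" "r n \<le> 1" for n
    using nonneg[of n] le[of n] Rinf by (auto simp: r_def divide_le_eq_1)
  define K where "K z = gw_counts z (geoms (map e (rev [1..<Suc m])))" for z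
  have Zstar: "Zstar_law e m = bind_pmf (geom_plus (r m)) K"
    by (simp only: Zstar_law_def K_def[abs_def] r_def geoms_rev_env[OF e])
  have bound: "?d n S \<le> 1 - r n" if "m \<le> n" for n S
  proof -
    let ?l = "map e (rev [1..<Suc n])"
    define q where "q = (1 + Rinv_env e m) / (1 + Rinv_env e n)"
    have q: "0 < q" "q \<le> 1"
      using nonneg[of m] nonneg[of n] incseqD[OF incseq_Rinv_env[OF e] that] by (auto simp: q_def divide_le_eq_1)
    have rq: "r n * q = r m"
      using nonneg[of n] Rinf by (simp add: r_def q_def)
    have "qcond_prob (tree_rev e n) {T. map (Zred T) [n - m..<Suc n] \<in> S} {T. gen_size T n > 0}
        = qcond_prob (tree_rev e n) {T. drop (n - m) (cnt 1 T) \<in> S} {T. gen_size T n > 0}"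
      by (rule qcond_prob_cong)
         (auto simp: tree_rev_LFs map_Zred_eq_drop_cnt simp del: upt_Suc One_nat_def dest!: gw_tree_support)
    also have "\<dots> = measure_pmf.prob (bind_pmf (geom_plus q) K) S"
      unfolding tree_rev_LFs K_def q_def rev_env_param[OF e that, symmetric]
      by (rule qcond_drop_cnt) (use admissible_env(2)[OF e] in \<open>auto simp del: upt_Suc set_map set_upt set_rev\<close>)
    finally show ?thesis
      using geom_plus_bind_close[OF r[of n] q, of K S] by (simp add: Zstar rq)
  qed
  have "(\<lambda>n. 1 - r n) \<longlonglongrightarrow> 1 - (1 + Rinv_inf e) / (1 + Rinv_inf e)"
    unfolding r_def using Rinf by (intro tendsto_intros lim) auto
  then have lim0: "(\<lambda>n. 1 - r n) \<longlonglongrightarrow> 0"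
    using Rinf by simp
  show ?thesis
  proof (rule tendsto_sandwich[OF _ _ tendsto_const lim0])
    show "eventually (\<lambda>n. 0 \<le> (SUP S. ?d n S)) sequentially"
      using eventually_ge_at_top[of m]
    proof eventually_elim
      case (elim n)
      \<comment> \<open>Any set would serve as a witness; \<open>bound\<close> also provides the
        upper bound that the supremum needs.\<close>
      have "?d n {} \<le> (SUP S. ?d n S)"
        by (rule cSUP_upper[OF UNIV_I bdd_aboveI2]) (rule bound[OF elim])
      then show ?case
        by (rule order_trans[OF abs_ge_zero])
    qed
    show "eventually (\<lambda>n. (SUP S. ?d n S) \<le> 1 - r n) sequentially"
      using eventually_ge_at_top[of m] by eventually_elim (rule cSUP_least, simp, rule bound)
  qed
qed

section \<open>Quenched limit in the forward environment\<close>

lemma sum_ln_Pi_env: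
  assumes "good_env e"
  shows "(\<Sum>k<n. ln (fst (e (Suc k)))) = ln (Pi_env e n)"
proof (induction n)
  case (Suc n)
  then show ?case
    using Pi_env_pos[OF assms, of n] good_envD(1)[OF assms, of "Suc n"] by (simp add: ln_mult)
qed simp

text \<open>\<open>R_env e m\<close> grows at most like
  \<open>m * exp ((\<mu> + \<delta>) * m)\<close>, while \<open>Pi_env e n\<close> is at least
  \<open>exp ((\<mu> - \<delta>) * n)\<close> eventually. Since \<open>ms n\<close> stays below
  \<open>\<rho> * n\<close> with \<open>\<rho> < 1\<close>, the product in the denominator
  wins.\<close>

lemma tendsto_qcond_tree_fwd:
  assumes e: "good_env e"
    and ms: "\<And>n. 1 \<le> n \<Longrightarrow> ms n \<le> n" "limsup (\<lambda>n. ereal (real (ms n) / real n)) < 1"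
    and lnA: "(\<lambda>n. (\<Sum>k<n. ln (fst (e (Suc k)))) / real n) \<longlonglongrightarrow> \<mu>" and "0 < \<mu>"
    and lnB: "(\<lambda>n. (\<Sum>k<n. ln (snd (e (Suc k)))) / real n) \<longlonglongrightarrow> \<beta>"
  shows "(\<lambda>n. qcond_prob (tree_fwd e n) {T. Zred T (ms n) > 1} {T. gen_size T n > 0}) \<longlonglongrightarrow> 0"
proof -
  note lnPi = sum_ln_Pi_env[OF e]
  have frac: "(\<lambda>n. real n / real (Suc n)) \<longlonglongrightarrow> 1"
    by (rule LIMSEQ_n_over_Suc_n)
  \<comment> \<open>These are the increments of \<open>R_env\<close>.\<close>
  define t where "t k = Pi_env e k * snd (e (Suc k))" for k
  have t_pos: "0 < t k" for k
    using Pi_env_pos[OF e] good_envD[OF e] by (simp add: t_def)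
  have "(\<lambda>n. ln (t n) / real (Suc n)) \<longlonglongrightarrow> \<mu>"
  proof -
    \<comment> \<open>The single term \<open>ln (snd (e (Suc n)))\<close> is a difference of
      consecutive partial sums, hence negligible against \<open>n\<close>; so
      \<open>ln (t n)\<close> grows at the rate of \<open>ln (Pi_env e n)\<close>.\<close>
    let ?sA = "\<lambda>n. \<Sum>k<n. ln (fst (e (Suc k)))" and ?sB = "\<lambda>n. \<Sum>k<n. ln (snd (e (Suc k)))"
    have "(\<lambda>n. ?sA n / real n * (real n / real (Suc n)) + (?sB (Suc n) / real (Suc n) - ?sB n / real n * (real n / real (Suc n))))
        \<longlonglongrightarrow> \<mu> * 1 + (\<beta> - \<beta> * 1)"
      by (intro tendsto_intros lnA frac LIMSEQ_Suc[OF lnB] lnB)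
    then have lim: "(\<lambda>n. ?sA n / real n * (real n / real (Suc n)) + (?sB (Suc n) / real (Suc n) - ?sB n / real n * (real n / real (Suc n))))
        \<longlonglongrightarrow> \<mu>"
      by simp
    have "?sA n / real n * (real n / real (Suc n)) + (?sB (Suc n) / real (Suc n) - ?sB n / real n * (real n / real (Suc n)))
        = ln (t n) / real (Suc n)" if "n \<ge> 1" for n
    proof -
      have cancel: "c / real n * (real n / real (Suc n)) = c / real (Suc n)" for c
        using that by simp
      have "ln (t n) = ?sA n + ln (snd (e (Suc n)))"
        unfolding t_def lnPi using Pi_env_pos[OF e, of n] good_envD(2)[OF e, of "Suc n"] by (simp add: ln_mult)
      then show ?thesis
        unfolding cancel by (simp add: add_divide_distrib del: of_nat_Suc)
    qed
    then show ?thesis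
      by (intro Lim_transform_eventually[OF lim eventually_sequentiallyI[of 1]])
  qed
  note lim_t = this
  obtain \<rho> where \<rho>: "limsup (\<lambda>n. ereal (real (ms n) / real n)) < ereal \<rho>" "ereal \<rho> < 1"
    using ereal_dense2[OF ms(2)] by blast
  have ev_ms: "eventually (\<lambda>n. real (ms n) / real n < \<rho>) sequentially"
    using Limsup_lessD[OF \<rho>(1)] by simp
  have \<rho>1: "\<rho> < 1"
    using \<rho>(2) by simp
  have "\<exists>n. real (ms n) / real n < \<rho>"
    using ev_ms eventually_happens' sequentially_bot by blast
  then have \<rho>0: "0 < \<rho>"
    by (metis divide_nonneg_nonneg le_less_trans of_nat_0_le_iff)
  \<comment> \<open>This makes \<open>\<mu> * \<rho> = \<mu> - 4 * \<delta>\<close>: enough for an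
    error \<open>\<delta>\<close> in each of the two growth rates and a remaining decay rate
    \<open>\<delta>\<close>.\<close>
  define \<delta> where "\<delta> = \<mu> * (1 - \<rho>) / 4"
  have \<delta>: "0 < \<delta>"
    using \<open>0 < \<mu>\<close> \<rho>1 by (simp add: \<delta>_def)
  have "eventually (\<lambda>n. ln (t n) / real (Suc n) < \<mu> + \<delta>) sequentially"
    by (rule order_tendstoD(2)[OF lim_t]) (use \<delta> in simp)
  then obtain N where N: "\<And>n. n \<ge> N \<Longrightarrow> ln (t n) / real (Suc n) < \<mu> + \<delta>"
    by (auto simp: eventually_sequentially)
  \<comment> \<open>The constant absorbs the finitely many increments before the exponential bound
    sets in.\<close>
  define C where "C = 1 + (\<Sum>k<N. t k)"
  have C: "1 \<le> C" "\<And>k. k < N \<Longrightarrow> t k \<le> C"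
  proof -
    show "1 \<le> C"
      using sum_nonneg[of "{..<N}" t] t_pos by (simp add: C_def less_imp_le)
    show "t k \<le> C" if "k < N" for k
      using member_le_sum[of k "{..<N}" t] that t_pos by (simp add: C_def less_imp_le)
  qed
  have t_le: "t k \<le> C * exp ((\<mu> + \<delta>) * real (Suc k))" for k
  proof (cases "k < N")
    case True
    have "1 \<le> exp ((\<mu> + \<delta>) * real (Suc k))"
      using \<open>0 < \<mu>\<close> \<delta> by simp
    then have "C * 1 \<le> C * exp ((\<mu> + \<delta>) * real (Suc k))"
      using C(1) by (intro mult_left_mono) auto
    then show ?thesis
      using C(2)[OF True] by linarith
  next
    case False
    then have "ln (t k) \<le> (\<mu> + \<delta>) * real (Suc k)"
      using N[of k] by (simp add: divide_less_eq)
    then have "t k \<le> exp ((\<mu> + \<delta>) * real (Suc k))"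
      using t_pos[of k] by (metis exp_le_cancel_iff exp_ln)
    also have "\<dots> \<le> C * exp ((\<mu> + \<delta>) * real (Suc k))"
      using C(1) mult_right_mono[of 1 C "exp ((\<mu> + \<delta>) * real (Suc k))"] by simp
    finally show ?thesis .
  qed
  have R_eq: "R_env e m = (\<Sum>k<m. t k)" for m
    by (induction m) (auto simp: t_def)
  have R_le: "R_env e m \<le> real m * (C * exp ((\<mu> + \<delta>) * real m))" for m
  proof -
    have "R_env e m \<le> (\<Sum>k<m. C * exp ((\<mu> + \<delta>) * real m))"
      unfolding R_eq
    proof (rule sum_mono)
      fix k assume "k \<in> {..<m}"
      then have "(\<mu> + \<delta>) * real (Suc k) \<le> (\<mu> + \<delta>) * real m"
        using \<open>0 < \<mu>\<close> \<delta> by (intro mult_left_mono) auto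
      then show "t k \<le> C * exp ((\<mu> + \<delta>) * real m)"
        using t_le[of k] C(1) by (meson exp_le_cancel_iff mult_left_mono order_trans zero_le_one)
    qed
    then show ?thesis
      by simp
  qed
  have ev_Pi: "eventually (\<lambda>n. \<mu> - \<delta> < ln (Pi_env e n) / real n) sequentially"
    using order_tendstoD(1)[OF lnA, of "\<mu> - \<delta>"] \<delta> by (simp add: lnPi)
  have "eventually (\<lambda>n. R_env e (ms n) / (Pi_env e n + R_env e n) \<le> C * (real n * exp (- (\<delta> * real n)))) sequentially"
    using ev_Pi ev_ms eventually_ge_at_top[of 1]
  proof eventually_elim
    case (elim n)
    have n: "0 < real n"
      using elim by simp
    have m: "real (ms n) \<le> \<rho> * real n" "real (ms n) \<le> real n"
      using elim ms(1)[of n] n by (auto simp: divide_less_eq)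
    have "(\<mu> - \<delta>) * real n \<le> ln (Pi_env e n)"
      using elim(1) n by (simp add: less_divide_eq)
    then have Pi: "exp ((\<mu> - \<delta>) * real n) \<le> Pi_env e n"
      using Pi_env_pos[OF e, of n] by (metis exp_le_cancel_iff exp_ln)
    have "(\<mu> + \<delta>) * real (ms n) \<le> (\<mu> + \<delta>) * (\<rho> * real n)"
      using m(1) \<open>0 < \<mu>\<close> \<delta> by (intro mult_left_mono) auto
    also have "\<dots> \<le> (\<mu> - \<delta> - \<delta>) * real n"
    proof -
      have "\<delta> * \<rho> \<le> \<delta> * 1"
        using \<delta> \<rho>1 by (intro mult_left_mono) auto
      moreover have "\<mu> * \<rho> = \<mu> - 4 * \<delta>"
        by (simp add: \<delta>_def field_simps)
      ultimately have "(\<mu> + \<delta>) * \<rho> \<le> \<mu> - \<delta> - \<delta>"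
        using \<delta> by (simp add: distrib_right)
      from mult_right_mono[OF this, of "real n"] show ?thesis
        by (simp add: mult.assoc)
    qed
    finally have exp_le: "exp ((\<mu> + \<delta>) * real (ms n)) \<le> exp ((\<mu> - \<delta>) * real n) * exp (- (\<delta> * real n))"
      by (simp flip: exp_add add: left_diff_distrib)
    have "R_env e (ms n) \<le> real n * (C * (exp ((\<mu> - \<delta>) * real n) * exp (- (\<delta> * real n))))"
      using R_le[of "ms n"] m(2) C(1) exp_le
      by (elim order_trans) (intro mult_mono, auto)
    also have "\<dots> \<le> real n * (C * (Pi_env e n * exp (- (\<delta> * real n))))"
      using Pi C(1) by (intro mult_left_mono mult_right_mono) auto
    finally have "R_env e (ms n) \<le> C * (real n * exp (- (\<delta> * real n))) * Pi_env e n"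
      by (simp add: mult_ac)
    also have "\<dots> \<le> C * (real n * exp (- (\<delta> * real n))) * (Pi_env e n + R_env e n)"
      using R_env_nonneg[OF e, of n] C(1) by (intro mult_left_mono) auto
    finally show ?case
      using Pi_env_pos[OF e, of n] R_env_nonneg[OF e, of n] by (simp add: divide_le_eq)
  qed
  moreover have "(\<lambda>n. C * (real n * exp (- (\<delta> * real n)))) \<longlonglongrightarrow> C * 0"
    by (intro tendsto_mult tendsto_const) (use \<delta> in real_asymp)
  moreover have "eventually (\<lambda>n. 0 \<le> R_env e (ms n) / (Pi_env e n + R_env e n)) sequentially"
    using Pi_env_pos[OF e] R_env_nonneg[OF e] by (simp add: less_imp_le add_nonneg_nonneg)
  ultimately have "(\<lambda>n. R_env e (ms n) / (Pi_env e n + R_env e n)) \<longlonglongrightarrow> 0"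
    by (auto intro: tendsto_sandwich[OF _ _ tendsto_const])
  moreover have "eventually (\<lambda>n. R_env e (ms n) / (Pi_env e n + R_env e n)
      = qcond_prob (tree_fwd e n) {T. Zred T (ms n) > 1} {T. gen_size T n > 0}) sequentially"
    using eventually_ge_at_top[of 1] by eventually_elim (simp add: qcond_tree_fwd[OF e] ms(1) del: One_nat_def)
  ultimately show ?thesis
    by (rule Lim_transform_eventually)
qed

section \<open>Random walks with finite variance\<close>

context prob_space
begin

lemma expectation_sum_square_orthogonal:
  fixes Y :: "nat \<Rightarrow> 'a \<Rightarrow> real"
  assumes int: "\<And>i j. integrable M (\<lambda>x. Y i x * Y j x)"
    and orth: "\<And>i j. expectation (\<lambda>x. Y i x * Y j x) = (if i = j then v else 0)"
    and fin: "finite I"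
  shows "integrable M (\<lambda>x. (\<Sum>i\<in>I. Y i x)\<^sup>2)" "expectation (\<lambda>x. (\<Sum>i\<in>I. Y i x)\<^sup>2) = real (card I) * v"
proof -
  have eq: "(\<Sum>i\<in>I. Y i x)\<^sup>2 = (\<Sum>i\<in>I. \<Sum>j\<in>I. Y i x * Y j x)" for x
    by (simp add: power2_eq_square sum_product)
  show "integrable M (\<lambda>x. (\<Sum>i\<in>I. Y i x)\<^sup>2)"
    unfolding eq by (intro Bochner_Integration.integrable_sum int)
  show "expectation (\<lambda>x. (\<Sum>i\<in>I. Y i x)\<^sup>2) = real (card I) * v"
    unfolding eq using fin
    by (simp add: Bochner_Integration.integral_sum Bochner_Integration.integrable_sum int orth)
qed

text \<open>Second moments are summable along the squares \<open>K\<^sup>2\<close>, and the blocks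
  between consecutive squares are short enough to be controlled by summing all their squared partial
  sums.\<close>

lemma strong_law_orthogonal:
  fixes Y :: "nat \<Rightarrow> 'a \<Rightarrow> real"
  assumes int: "\<And>i j. integrable M (\<lambda>x. Y i x * Y j x)"
    and orth: "\<And>i j. expectation (\<lambda>x. Y i x * Y j x) = (if i = j then v else 0)"
    and meas [measurable]: "\<And>i. random_variable borel (Y i)"
  shows "AE x in M. (\<lambda>n. (\<Sum>i<n. Y i x) / real n) \<longlonglongrightarrow> 0"
proof -
  \<comment> \<open>\<open>W K\<close> controls the averages for all times between \<open>K\<^sup>2\<close> and \<open>(K + 1)\<^sup>2\<close>; its expectation
    is of order \<open>1 / K\<^sup>2\<close>, hence summable.\<close>
  define W where "W K x = (\<Sum>i<K\<^sup>2. Y i x)\<^sup>2 / real K ^ 4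
      + (\<Sum>n\<in>{K\<^sup>2..<(Suc K)\<^sup>2}. (\<Sum>i\<in>{K\<^sup>2..<n}. Y i x)\<^sup>2) / real K ^ 4" for K x
  note sq = expectation_sum_square_orthogonal[OF int orth]
  have v: "0 \<le> v"
    using sq(2)[of "{0}"] by (metis (no_types, lifting) card_1_singleton_iff integral_nonneg_AE AE_I2
        finite.intros mult_1 of_nat_1 zero_le_power2 One_nat_def)
  have W_nonneg: "0 \<le> W K x" for K x
    by (auto simp: W_def intro!: add_nonneg_nonneg divide_nonneg_nonneg sum_nonneg)
  have W_int: "integrable M (W K)" for K
    unfolding W_def[abs_def]
    by (intro Bochner_Integration.integrable_add Bochner_Integration.integrable_divide
        Bochner_Integration.integrable_sum sq(1)) auto
  \<comment> \<open>For \<open>K \<ge> 1\<close> a block has \<open>2 * K + 1 \<le> 3 * K\<close>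
    indices, whence the constant \<open>10 = 1 + 3 * 3\<close>. Starting at \<open>Suc k\<close>
    avoids division by 0.\<close>
  have W_le: "expectation (W (Suc k)) \<le> 10 * v * (1 / real (Suc k) ^ 2)" for k
  proof -
    let ?K = "Suc k"
    have "expectation (W ?K) = real (?K\<^sup>2) * v / real ?K ^ 4
        + (\<Sum>n\<in>{?K\<^sup>2..<(Suc ?K)\<^sup>2}. real (n - ?K\<^sup>2) * v) / real ?K ^ 4"
      unfolding W_def
      by (subst Bochner_Integration.integral_add)
         (auto simp del: of_nat_Suc of_nat_power power_Suc simp: sq Bochner_Integration.integral_sum
           intro!: Bochner_Integration.integrable_divide Bochner_Integration.integrable_sum)
    also have "(\<Sum>n\<in>{?K\<^sup>2..<(Suc ?K)\<^sup>2}. real (n - ?K\<^sup>2) * v)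
        \<le> (\<Sum>n\<in>{?K\<^sup>2..<(Suc ?K)\<^sup>2}. real (3 * ?K) * v)"
    proof (rule sum_mono)
      fix n assume "n \<in> {?K\<^sup>2..<(Suc ?K)\<^sup>2}"
      then have "n - ?K\<^sup>2 \<le> 3 * ?K"
        by (auto simp: power2_eq_square)
      then show "real (n - ?K\<^sup>2) * v \<le> real (3 * ?K) * v"
        using v by (intro mult_right_mono) (auto simp only: of_nat_le_iff)
    qed
    also have "\<dots> = real ((Suc ?K)\<^sup>2 - ?K\<^sup>2) * (real (3 * ?K) * v)"
      by simp
    also have "\<dots> \<le> real (3 * ?K) * (real (3 * ?K) * v)"
    proof -
      have "(Suc ?K)\<^sup>2 - ?K\<^sup>2 \<le> 3 * ?K"
        by (auto simp: power2_eq_square)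
      then show ?thesis
        using v by (intro mult_right_mono mult_nonneg_nonneg) (auto simp only: of_nat_le_iff of_nat_0_le_iff)
    qed
    also have "real (?K\<^sup>2) * v / real ?K ^ 4 + real (3 * ?K) * (real (3 * ?K) * v) / real ?K ^ 4
        = 10 * v * (1 / real ?K ^ 2)"
    proof -
      define c where "c = real (Suc k)"
      have "c \<noteq> 0"
        by (simp add: c_def)
      then have "c\<^sup>2 * v / c ^ 4 + 3 * c * (3 * c * v) / c ^ 4 = 10 * v * (1 / c\<^sup>2)"
        by (simp add: field_simps power2_eq_square power4_eq_xxxx)
      then show ?thesis
        by (simp add: c_def)
    qed
    finally show ?thesis
      by (simp add: divide_right_mono)
  qed
  have summ: "summable (\<lambda>k. 10 * v * (1 / real (Suc k) ^ 2))"
    using summable_Suc_iff[THEN iffD2, OF inverse_power_summable[of 2, where 'a = real]]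
    by (intro summable_mult) (simp add: inverse_eq_divide del: of_nat_Suc)
  have [measurable]: "W K \<in> borel_measurable M" for K
    using W_int by auto
  \<comment> \<open>The sum of all \<open>W (Suc k)\<close> has finite expectation, hence is finite
    almost surely, and its terms tend to 0.\<close>
  have "(\<integral>\<^sup>+ x. (\<Sum>k. ennreal (W (Suc k) x)) \<partial>M) = (\<Sum>k. \<integral>\<^sup>+ x. ennreal (W (Suc k) x) \<partial>M)"
    by (rule nn_integral_suminf) measurable
  also have "\<dots> = (\<Sum>k. ennreal (expectation (W (Suc k))))"
    using W_int W_nonneg by (simp add: nn_integral_eq_integral)
  also have "\<dots> \<le> (\<Sum>k. ennreal (10 * v * (1 / real (Suc k) ^ 2)))"
    by (intro suminf_le summableI ennreal_leI W_le)
  also have "\<dots> < \<infinity>"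
    using summ v by (subst suminf_ennreal2) (auto simp: summable_Suc_iff)
  finally have "AE x in M. (\<Sum>k. ennreal (W (Suc k) x)) \<noteq> \<infinity>"
    by (intro nn_integral_PInf_AE) auto
  then show ?thesis
  proof eventually_elim
    case (elim x)
    then have "summable (\<lambda>k. W (Suc k) x)"
      using W_nonneg by (intro summable_suminf_not_top) auto
    then have "(\<lambda>k. W k x) \<longlonglongrightarrow> 0"
      by (intro LIMSEQ_imp_Suc[of "\<lambda>k. W k x"] summable_LIMSEQ_zero)
    moreover have "filterlim floor_sqrt at_top sequentially"
      unfolding filterlim_at_top
      by (intro allI eventually_sequentiallyI) (rule le_floor_sqrtI)
    ultimately have "(\<lambda>n. W (floor_sqrt n) x) \<longlonglongrightarrow> 0"
      by (rule filterlim_compose)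
    then have lim: "(\<lambda>n. sqrt (2 * W (floor_sqrt n) x)) \<longlonglongrightarrow> sqrt (2 * 0)"
      by (intro tendsto_intros)
    have bound: "\<bar>(\<Sum>i<n. Y i x) / real n\<bar> \<le> sqrt (2 * W (floor_sqrt n) x)" if n: "1 \<le> n" for n
    proof (rule real_le_rsqrt)
      \<comment> \<open>The sum up to \<open>n\<close> splits at the largest square below or equal
        to \<open>n\<close>; then \<open>(a + b)\<^sup>2 \<le> 2 * (a\<^sup>2 + b\<^sup>2)\<close>
        and both squares are part of \<open>W K\<close>.\<close>
      define K where "K = floor_sqrt n"
      have K: "K\<^sup>2 \<le> n" "n < (Suc K)\<^sup>2" "0 < K"
        using n Suc_floor_sqrt_power2_gt[of n] by (auto simp: K_def)
      define a where "a = (\<Sum>i<K\<^sup>2. Y i x)"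
      define b where "b = (\<Sum>i\<in>{K\<^sup>2..<n}. Y i x)"
      have sum: "(\<Sum>i<n. Y i x) = a + b"
        using K(1) sum.atLeastLessThan_concat[of 0 "K\<^sup>2" n "\<lambda>i. Y i x"]
        by (simp add: a_def b_def lessThan_atLeast0)
      have K4: "real K ^ 4 \<le> real n ^ 2"
      proof -
        have "real K ^ 4 = (real (K\<^sup>2)) ^ 2"
          by simp
        also have "\<dots> \<le> real n ^ 2"
          using K(1) by (intro power_mono) (auto simp only: of_nat_le_iff of_nat_0_le_iff)
        finally show ?thesis .
      qed
      have "b\<^sup>2 \<le> (\<Sum>n\<in>{K\<^sup>2..<(Suc K)\<^sup>2}. (\<Sum>i\<in>{K\<^sup>2..<n}. Y i x)\<^sup>2)"
        unfolding b_def using K by (intro member_le_sum) auto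
      then have "a\<^sup>2 + b\<^sup>2 \<le> W K x * real K ^ 4"
        using K(3) by (simp add: W_def a_def distrib_right)
      moreover have "(a + b)\<^sup>2 \<le> 2 * (a\<^sup>2 + b\<^sup>2)"
        using sum_squares_ge_zero[of "a - b" 0] by (simp add: power2_eq_square algebra_simps)
      moreover have "W K x * real K ^ 4 \<le> W K x * real n ^ 2"
        using K4 W_nonneg by (intro mult_left_mono) auto
      ultimately have "(a + b)\<^sup>2 \<le> 2 * (W K x * real n ^ 2)"
        by (meson mult_left_mono order_trans zero_le_numeral)
      then show "\<bar>(\<Sum>i<n. Y i x) / real n\<bar>\<^sup>2 \<le> 2 * W (floor_sqrt n) x"
        using n by (simp add: sum K_def power_divide divide_le_eq mult.assoc)
    qed
    show ?case
      by (rule Lim_null_comparison[of _ "\<lambda>n. sqrt (2 * W (floor_sqrt n) x)"])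
         (use lim bound in \<open>auto intro: eventually_sequentiallyI[of 1]\<close>)
  qed
qed

text \<open>After centring, independence gives orthogonality.\<close>

lemma strong_law_second_moment:
  fixes X :: "nat \<Rightarrow> 'a \<Rightarrow> real"
  assumes indep: "indep_vars (\<lambda>_. borel) X UNIV"
    and sq: "\<And>i. integrable M (\<lambda>x. (X i x)\<^sup>2)"
    and mean: "\<And>i. expectation (X i) = \<mu>"
    and var: "\<And>i. variance (X i) = v"
  shows "AE x in M. (\<lambda>n. (\<Sum>i<n. X i x) / real n) \<longlonglongrightarrow> \<mu>"
proof -
  have [measurable]: "random_variable borel (X i)" for i
    using indep by (simp add: indep_vars_def)
  have int: "integrable M (X i)" for i
    by (rule square_integrable_imp_integrable[OF _ sq]) measurable
  define Y where "Y i x = X i x - \<mu>" for i x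
  have [measurable]: "random_variable borel (Y i)" for i
    unfolding Y_def[abs_def] by measurable
  have Y_int: "integrable M (Y i)" for i
    unfolding Y_def[abs_def] using int by simp
  have Y0: "expectation (Y i) = 0" for i
    using int mean by (simp add: Y_def[abs_def] prob_space)
  have indep_Y: "indep_vars (\<lambda>_. borel) Y UNIV"
    unfolding Y_def[abs_def] by (rule indep_vars_compose2[OF indep]) measurable
  have Ysq: "integrable M (\<lambda>x. Y i x * Y i x)" for i
    using int[of i] sq[of i] by (simp add: Y_def power2_eq_square algebra_simps)
  have pair: "indep_var borel (Y i) borel (Y j)" if "i \<noteq> j" for i j
    using indep_vars_sum[of "{j}" i Y] indep_vars_subset[OF indep_Y, of "insert i {j}"] that by simp
  have "AE x in M. (\<lambda>n. (\<Sum>i<n. Y i x) / real n) \<longlonglongrightarrow> 0"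
  proof (rule strong_law_orthogonal[where v = v])
    show "integrable M (\<lambda>x. Y i x * Y j x)" for i j
      using Ysq pair[of i j] indep_var_integrable[OF pair[of i j] Y_int Y_int] by (cases "i = j") auto
    show "expectation (\<lambda>x. Y i x * Y j x) = (if i = j then v else 0)" for i j
      using indep_var_lebesgue_integral[OF pair[of i j] Y_int Y_int] var[of i] mean[of i]
      by (auto simp: Y0) (simp add: Y_def power2_eq_square)
  qed measurable
  then show ?thesis
  proof eventually_elim
    case (elim x)
    have "(\<lambda>n. (\<Sum>i<n. Y i x) / real n + \<mu>) \<longlonglongrightarrow> 0 + \<mu>"
      by (intro tendsto_intros elim)
    moreover have "eventually (\<lambda>n. (\<Sum>i<n. Y i x) / real n + \<mu> = (\<Sum>i<n. X i x) / real n) sequentially"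
      using eventually_gt_at_top[of 0]
      by eventually_elim (simp add: Y_def sum_subtractf field_simps)
    ultimately show ?case
      by (auto intro: Lim_transform_eventually)
  qed
qed

text \<open>By the central limit theorem the centred walk is nonpositive with asymptotically
  positive probability, and a nonpositive mean only pushes the walk further down. Zero variance,
  where the theorem does not apply, is treated separately.\<close>

lemma random_walk_nonpos_mean:
  fixes X :: "nat \<Rightarrow> 'a \<Rightarrow> real"
  assumes indep: "indep_vars (\<lambda>_. borel) X UNIV"
    and sq: "\<And>i. integrable M (\<lambda>x. (X i x)\<^sup>2)"
    and distr: "\<And>i. distr M borel (X i) = N"
    and mean: "expectation (X 0) \<le> 0"
  shows "\<exists>\<delta>>0. eventually (\<lambda>n. \<delta> \<le> prob {x \<in> space M. (\<Sum>i<n. X i x) \<le> 0}) sequentially"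
proof -
  have [measurable]: "random_variable borel (X i)" for i
    using indep by (simp add: indep_vars_def)
  have int: "integrable M (X i)" for i
    by (rule square_integrable_imp_integrable[OF _ sq]) measurable
  define \<mu> where "\<mu> = expectation (X 0)"
  define v where "v = variance (X 0)"
  have transfer: "expectation (\<lambda>x. f (X i x)) = expectation (\<lambda>x. f (X 0 x))"
    if [measurable]: "f \<in> borel_measurable borel" for f :: "real \<Rightarrow> real" and i
    using distr[of i] distr[of 0] integral_distr[of "X i" M borel f] integral_distr[of "X 0" M borel f]
    by simp
  have mean_i: "expectation (X i) = \<mu>" for i
    using transfer[of "\<lambda>x. x" i] by (simp add: \<mu>_def)
  have var_i: "variance (X i) = v" for i
    using transfer[of "\<lambda>x. (x - \<mu>)\<^sup>2" i] by (simp add: v_def mean_i)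
  have v: "0 \<le> v"
    unfolding v_def by (rule variance_positive)
  show ?thesis
  proof (cases "v = 0")
    case True
    have "AE x in M. \<forall>i. X i x = \<mu>"
    proof (subst AE_all_countable, rule allI)
      fix i
      have "integrable M (\<lambda>x. (X i x - \<mu>)\<^sup>2)"
        using int[of i] sq[of i] by (simp add: power2_diff)
      then have "AE x in M. (X i x - \<mu>)\<^sup>2 = 0"
        using var_i[of i] True by (subst integral_nonneg_eq_0_iff_AE[symmetric]) (auto simp: mean_i)
      then show "AE x in M. X i x = \<mu>"
        by simp
    qed
    then have "AE x in M. (\<Sum>i<n. X i x) \<le> 0" for n
      by eventually_elim (use mean in \<open>auto simp: \<mu>_def mult_nonneg_nonpos\<close>)
    then have "prob {x \<in> space M. (\<Sum>i<n. X i x) \<le> 0} = 1" for n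
      by (subst prob_Collect_eq_1) auto
    then show ?thesis
      by (intro exI[of _ 1]) auto
  next
    case False
    define S where "S n x = (\<Sum>i<n. X i x - \<mu>) / sqrt (real n * (sqrt v)\<^sup>2)" for n x
    have conv: "weak_conv_m (\<lambda>n. distr M borel (S n)) std_normal_distribution"
      unfolding S_def[abs_def]
      by (rule central_limit_theorem[where \<mu> = N]) (use indep sq distr False v mean_i var_i in auto)
    interpret nd: real_distribution std_normal_distribution
      by (rule real_dist_normal_dist)
    have "measure std_normal_distribution {0} = 0"
      by (simp add: measure_def emeasure_density)
    then have "isCont (cdf std_normal_distribution) 0"
      by (simp add: nd.isCont_cdf)
    then have lim: "(\<lambda>n. cdf (distr M borel (S n)) 0) \<longlonglongrightarrow> cdf std_normal_distribution 0"
      using conv by (simp add: weak_conv_m_def weak_conv_def)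
    \<comment> \<open>The normal density is positive everywhere, so a zero value would make the
      half-line Lebesgue-null.\<close>
    have "cdf std_normal_distribution 0 \<noteq> 0"
    proof
      assume "cdf std_normal_distribution 0 = 0"
      then have "emeasure std_normal_distribution {..0} = 0"
        by (simp add: cdf_def nd.emeasure_eq_measure)
      then have "AE x in lborel. ennreal (std_normal_density x) * indicator {..0} x = 0"
        by (simp add: emeasure_density nn_integral_0_iff_AE)
      then have "AE x in lborel. x \<notin> {..0::real}"
        by eventually_elim (use normal_density_pos[of 1 0] in
            \<open>auto simp: indicator_def ennreal_eq_0_iff simp flip: not_less split: if_splits\<close>)
      then have "emeasure lborel {..0::real} = 0"
        by (subst (asm) AE_iff_measurable[OF _ refl]) (auto simp: atMost_def)
      then have "emeasure lborel {-1..0::real} = 0"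
        by (rule emeasure_eq_0[rotated 1]) auto
      then show False
        by simp
    qed
    then have c: "0 < cdf std_normal_distribution 0"
      using nd.cdf_nonneg[of 0] by linarith
    define \<delta> where "\<delta> = cdf std_normal_distribution 0 / 2"
    have "eventually (\<lambda>n. \<delta> < cdf (distr M borel (S n)) 0) sequentially"
      by (rule order_tendstoD(1)[OF lim]) (use c in \<open>simp add: \<delta>_def\<close>)
    then have "eventually (\<lambda>n. \<delta> \<le> prob {x \<in> space M. (\<Sum>i<n. X i x) \<le> 0}) sequentially"
      using eventually_gt_at_top[of 0]
    proof eventually_elim
      case (elim n)
      have [measurable]: "random_variable borel (S n)"
        unfolding S_def[abs_def] by measurable
      have "cdf (distr M borel (S n)) 0 = prob {x \<in> space M. S n x \<le> 0}"
        unfolding cdf_def by (subst measure_distr) (auto intro!: arg_cong[where f = prob])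
      also have "\<dots> \<le> prob {x \<in> space M. (\<Sum>i<n. X i x) \<le> 0}"
      proof (rule finite_measure_mono)
        show "{x \<in> space M. S n x \<le> 0} \<subseteq> {x \<in> space M. (\<Sum>i<n. X i x) \<le> 0}"
        proof safe
          fix x assume "S n x \<le> 0"
          moreover have "0 < sqrt (real n * (sqrt v)\<^sup>2)"
            using elim False v by simp
          ultimately have "(\<Sum>i<n. X i x - \<mu>) \<le> 0"
            unfolding S_def by (metis divide_pos_pos not_le)
          then have "(\<Sum>i<n. X i x) \<le> real n * \<mu>"
            by (simp add: sum_subtractf)
          also have "\<dots> \<le> 0"
            using mean by (simp add: \<mu>_def mult_nonneg_nonpos)
          finally show "(\<Sum>i<n. X i x) \<le> 0" .
        qed
      qed measurable
      finally show ?case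
        using elim by simp
    qed
    then show ?thesis
      using c by (intro exI[of _ \<delta>]) (simp add: \<delta>_def)
  qed
qed

end

section \<open>I.i.d. environments\<close>

locale iid_env = prob_space D for D :: "(real \<times> real) measure" +
  assumes sets_D: "sets D = sets borel"
begin

abbreviation P :: "env measure" where "P \<equiv> PiM UNIV (\<lambda>_. D)"

lemma prob_P: "prob_space P"
  by (rule prob_space_PiM) (rule prob_space_axioms)

lemma space_D: "space D = UNIV"
  using sets_eq_imp_space_eq[OF sets_D] by simp

lemma space_P: "space P = UNIV"
  by (simp add: space_PiM space_D)

lemma measurable_coord: "(\<lambda>e. e k) \<in> measurable P D"
  by (rule measurable_component_singleton) simp

lemma measurable_D: "f \<in> borel_measurable borel \<Longrightarrow> f \<in> borel_measurable D"
  by (simp cong: measurable_cong_sets add: sets_D)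

lemma measurable_fst_snd_borel:
  "fst \<in> borel_measurable (borel :: (real \<times> real) measure)"
  "snd \<in> borel_measurable (borel :: (real \<times> real) measure)"
  by (intro borel_measurable_continuous_onI continuous_intros)+

lemma measurable_ln_fst_snd:
  "(\<lambda>x. ln (fst x)) \<in> borel_measurable (borel :: (real \<times> real) measure)"
  "(\<lambda>x. ln (snd x)) \<in> borel_measurable (borel :: (real \<times> real) measure)"
  by (intro borel_measurable_ln measurable_fst_snd_borel)+

lemma measurable_fst_snd_D [measurable]: "fst \<in> borel_measurable D" "snd \<in> borel_measurable D"
  by (intro measurable_D measurable_fst_snd_borel)+

lemma measurable_fst_snd_coord [measurable]:
  "(\<lambda>e. fst (e k)) \<in> borel_measurable P" "(\<lambda>e. snd (e k)) \<in> borel_measurable P"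
  by (rule measurable_compose[OF measurable_coord measurable_fst_snd_D(1)]
        measurable_compose[OF measurable_coord measurable_fst_snd_D(2)])+

lemma distr_coord: "distr P D (\<lambda>e. e k) = D"
  by (rule distr_PiM_component) (simp_all add: prob_space_axioms)

text \<open>Applied to the shift \<open>Suc\<close>, for the independence of the coordinates, and to
  the finite reversal \<open>flip_env\<close>, for exchangeability.\<close>

lemma distr_reindex: "inj f \<Longrightarrow> distr P P (\<lambda>e n. e (f n)) = P"
  using distr_PiM_reindex[of UNIV "\<lambda>_. D" f UNIV] prob_space_axioms by (simp add: restrict_def)

lemma AE_coord: "AE x in D. Q x \<Longrightarrow> AE e in P. Q (e k)"
  by (rule AE_PiM_component[of UNIV "\<lambda>_. D" k]) (simp_all add: prob_space_axioms)

lemma integral_coord: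
  fixes f :: "real \<times> real \<Rightarrow> real"
  assumes "f \<in> borel_measurable borel"
  shows "(\<integral>e. f (e k) \<partial>P) = (\<integral>x. f x \<partial>D)"
  using integral_distr[of "\<lambda>e. e k" P D f] measurable_D[OF assms]
  by (simp add: distr_coord measurable_coord)

lemma integrable_coord:
  fixes f :: "real \<times> real \<Rightarrow> real"
  assumes "integrable D f"
  shows "integrable P (\<lambda>e. f (e k))"
  using integrable_distr[of "\<lambda>e. e k" P D f] assms
  by (simp add: distr_coord measurable_coord)

text \<open>The shift by \<open>Suc\<close> is there because environments are numbered from 1 while
  the sums run over \<open>k < n\<close>.\<close>

lemma indep_vars_coord:
  fixes f :: "real \<times> real \<Rightarrow> real"
  assumes [measurable]: "f \<in> borel_measurable borel"
  shows "prob_space.indep_vars P (\<lambda>_. borel) (\<lambda>i e. f (e (Suc i))) UNIV"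
proof -
  interpret P: prob_space P
    by (rule prob_P)
  have "P.indep_vars (\<lambda>_. D) (\<lambda>i e. e (Suc i)) UNIV"
    by (subst P.indep_vars_iff_distr_eq_PiM')
       (auto simp: measurable_coord distr_coord distr_reindex restrict_def)
  then show ?thesis
    by (rule P.indep_vars_compose2) (rule measurable_D[OF assms])
qed

lemma distr_coord_borel:
  fixes f :: "real \<times> real \<Rightarrow> real"
  assumes "f \<in> borel_measurable borel"
  shows "distr P borel (\<lambda>e. f (e k)) = distr D borel f"
  using distr_distr[of f D borel "\<lambda>e. e k" P] measurable_D[OF assms]
  by (simp add: distr_coord measurable_coord o_def)

lemma strong_law_coord:
  fixes f :: "real \<times> real \<Rightarrow> real"
  assumes [measurable]: "f \<in> borel_measurable borel" and sq: "integrable D (\<lambda>x. (f x)\<^sup>2)"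
  shows "AE e in P. (\<lambda>n. (\<Sum>k<n. f (e (Suc k))) / real n) \<longlonglongrightarrow> (\<integral>x. f x \<partial>D)"
proof -
  interpret P: prob_space P
    by (rule prob_P)
  show ?thesis
  proof (rule P.strong_law_second_moment[where v = "\<integral>x. (f x - (\<integral>x. f x \<partial>D))\<^sup>2 \<partial>D"])
    show "P.indep_vars (\<lambda>_. borel) (\<lambda>i e. f (e (Suc i))) UNIV"
      by (rule indep_vars_coord) fact
    show "integrable P (\<lambda>e. (f (e (Suc i)))\<^sup>2)" for i
      using integrable_coord[OF sq] .
    show mean: "(\<integral>e. f (e (Suc i)) \<partial>P) = (\<integral>x. f x \<partial>D)" for i
      by (rule integral_coord) fact
    show "(\<integral>e. (f (e (Suc i)) - (\<integral>e. f (e (Suc i)) \<partial>P))\<^sup>2 \<partial>P) = (\<integral>x. (f x - (\<integral>x. f x \<partial>D))\<^sup>2 \<partial>D)" for i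
      unfolding mean by (rule integral_coord) measurable
  qed
qed

section \<open>Subcriticality forces a positive mean of \<open>ln (fst x)\<close>\<close>

lemma AE_good_env:
  assumes "AE x in D. admissible x"
  shows "AE e in P. good_env e"
  unfolding good_env_def by (subst AE_all_countable) (auto intro: AE_coord[OF assms])

lemma measurable_Pi_env [measurable]: "(\<lambda>e. Pi_env e n) \<in> borel_measurable P"
  unfolding Pi_env_def by measurable

lemma measurable_R_env [measurable]: "(\<lambda>e. R_env e n) \<in> borel_measurable P"
  unfolding R_env_def by measurable

text \<open>Otherwise \<open>Pi_env e n \<le> 1\<close> has probability at least some
  \<open>\<delta> > 0\<close> for all large \<open>n\<close>. Excluding a small value of
  \<open>snd (e n)\<close> costs less than \<open>\<delta> / 2\<close>, and on the remaining event
  the \<open>n\<close>-th term of the convergent series \<open>Rinv_env\<close> stays above a fixed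
  \<open>c > 0\<close>.\<close>

lemma ln_mean_pos:
  assumes supp: "AE x in D. admissible x"
    and conv: "AE e in P. convergent (Rinv_env e)"
    and sq: "integrable D (\<lambda>x. (ln (fst x))\<^sup>2)"
  shows "0 < (\<integral>x. ln (fst x) \<partial>D)"
proof (rule ccontr)
  interpret P: prob_space P
    by (rule prob_P)
  let ?S = "\<lambda>n e. \<Sum>k<n. ln (fst (e (Suc k)))"
  note m = measurable_ln_fst_snd(1)
  assume "\<not> 0 < (\<integral>x. ln (fst x) \<partial>D)"
  then obtain \<delta> where \<delta>: "0 < \<delta>" "eventually (\<lambda>n. \<delta> \<le> P.prob {e \<in> space P. ?S n e \<le> 0}) sequentially"
    using P.random_walk_nonpos_mean[OF indep_vars_coord[OF m] integrable_coord[OF sq] distr_coord_borel[OF m]]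
      integral_coord[OF m] by auto
  \<comment> \<open>Since \<open>snd x > 0\<close> almost surely, these events decrease to a null
    event; this yields the threshold \<open>c\<close>.\<close>
  have "decseq (\<lambda>i. {x \<in> space D. snd x \<le> 1 / real (Suc i)})"
    by (rule decseq_SucI) (auto elim!: order_trans simp: frac_le)
  then have "(\<lambda>i. prob {x \<in> space D. snd x \<le> 1 / real (Suc i)}) \<longlonglongrightarrow> prob (\<Inter>i. {x \<in> space D. snd x \<le> 1 / real (Suc i)})"
    by (intro finite_Lim_measure_decseq) auto
  also have "prob (\<Inter>i. {x \<in> space D. snd x \<le> 1 / real (Suc i)}) = prob {}"
  proof (rule finite_measure_eq_AE)
    show "AE x in D. x \<in> (\<Inter>i. {x \<in> space D. snd x \<le> 1 / real (Suc i)}) \<longleftrightarrow> x \<in> {}"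
      using supp
    proof eventually_elim
      case (elim x)
      then have "0 < snd x"
        by (simp add: admissible_def)
      then obtain i where "inverse (real (Suc i)) < snd x"
        using reals_Archimedean by blast
      then show ?case
        by (auto simp: inverse_eq_divide not_le intro!: exI[of _ i])
    qed
  qed auto
  finally have "(\<lambda>i. prob {x \<in> space D. snd x \<le> 1 / real (Suc i)}) \<longlonglongrightarrow> 0"
    by simp
  then have "eventually (\<lambda>i. prob {x \<in> space D. snd x \<le> 1 / real (Suc i)} < \<delta> / 2) sequentially"
    by (rule order_tendstoD) (use \<delta> in simp)
  then obtain i where i: "prob {x \<in> space D. snd x \<le> 1 / real (Suc i)} < \<delta> / 2"
    using eventually_happens' sequentially_bot by blast
  define c where "c = 1 / real (Suc i)"
  have c: "0 < c"
    by (simp add: c_def)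
  have Bc: "P.prob {e \<in> space P. snd (e k) \<le> c} < \<delta> / 2" for k
  proof -
    have sets: "{x \<in> space D. snd x \<le> c} \<in> sets D"
      by measurable
    have "prob {x \<in> space D. snd x \<le> c} = measure (distr P D (\<lambda>e. e k)) {x \<in> space D. snd x \<le> c}"
      by (simp add: distr_coord)
    also have "\<dots> = P.prob {e \<in> space P. snd (e k) \<le> c}"
      by (subst measure_distr[OF measurable_coord sets]) (auto simp: space_D space_P intro!: arg_cong[where f = P.prob])
    finally show ?thesis
      using i by (simp add: c_def)
  qed
  \<comment> \<open>On \<open>?E n\<close> the new term of \<open>Rinv_env\<close> exceeds
    \<open>c\<close>, so almost surely only finitely many of these events occur, and dominated
    convergence sends their probabilities to 0.\<close>
  let ?E = "\<lambda>n. {e \<in> space P. ?S (Suc n) e \<le> 0 \<and> c < snd (e (Suc n))}"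
  have "(\<lambda>n. \<integral>e. (indicator (?E n) e :: real) \<partial>P) \<longlonglongrightarrow> (\<integral>e. 0 \<partial>P)"
  proof (rule integral_dominated_convergence[where w = "\<lambda>_. 1"])
    show "AE e in P. (\<lambda>n. indicator (?E n) e :: real) \<longlonglongrightarrow> 0"
      using conv AE_good_env[OF supp]
    proof eventually_elim
      case (elim e)
      then obtain L where L: "Rinv_env e \<longlonglongrightarrow> L"
        by (auto simp: convergent_def)
      have "(\<lambda>n. Rinv_env e (Suc n) - Rinv_env e n) \<longlonglongrightarrow> L - L"
        by (intro tendsto_diff LIMSEQ_Suc L)
      then have "(\<lambda>n. snd (e (Suc n)) / Pi_env e (Suc n)) \<longlonglongrightarrow> 0"
        by (simp del: Pi_env_Suc)
      then have "eventually (\<lambda>n. snd (e (Suc n)) / Pi_env e (Suc n) < c) sequentially"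
        by (rule order_tendstoD) (rule c)
      then have "eventually (\<lambda>n. (0::real) = indicator (?E n) e) sequentially"
      proof eventually_elim
        case (elim n)
        have "\<not> (?S (Suc n) e \<le> 0 \<and> c < snd (e (Suc n)))"
        proof
          assume *: "?S (Suc n) e \<le> 0 \<and> c < snd (e (Suc n))"
          have "ln (Pi_env e (Suc n)) \<le> 0"
            using * by (simp only: sum_ln_Pi_env[OF \<open>good_env e\<close>])
          then have "Pi_env e (Suc n) \<le> 1"
            using Pi_env_pos[OF \<open>good_env e\<close>, of "Suc n"] by (simp only: ln_le_zero_iff)
          then have "snd (e (Suc n)) \<le> snd (e (Suc n)) / Pi_env e (Suc n)"
            using * c Pi_env_pos[OF \<open>good_env e\<close>, of "Suc n"]
            by (simp add: le_divide_eq mult_left_le del: Pi_env_Suc)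
          with elim * show False
            by linarith
        qed
        then show ?case
          by (simp add: indicator_def del: sum.lessThan_Suc)
      qed
      then show ?case
        by (rule Lim_transform_eventually[OF tendsto_const])
    qed
  qed (auto simp: indicator_def)
  then have "(\<lambda>n. P.prob (?E n)) \<longlonglongrightarrow> 0"
    by (simp add: Int_absorb2 space_P)
  then have "eventually (\<lambda>n. P.prob (?E n) < \<delta> / 2) sequentially"
    by (rule order_tendstoD) (use \<delta> in simp)
  moreover have "eventually (\<lambda>n. \<delta> \<le> P.prob {e \<in> space P. ?S (Suc n) e \<le> 0}) sequentially"
    using \<delta>(2) by (rule eventually_compose_filterlim[OF _ filterlim_Suc])
  ultimately have "eventually (\<lambda>n::nat. False) sequentially"
  proof eventually_elim
    case (elim n)
    \<comment> \<open>Splitting according to whether \<open>snd (e (Suc n))\<close> exceeds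
      \<open>c\<close> gives a total below \<open>\<delta> / 2 + \<delta> / 2\<close>.\<close>
    have "P.prob {e \<in> space P. ?S (Suc n) e \<le> 0}
        \<le> P.prob (?E n \<union> {e \<in> space P. snd (e (Suc n)) \<le> c})"
      by (rule P.finite_measure_mono) (auto simp del: sum.lessThan_Suc)
    also have "\<dots> \<le> P.prob (?E n) + P.prob {e \<in> space P. snd (e (Suc n)) \<le> c}"
      by (rule measure_Un_le) auto
    finally show ?case
      using elim Bc[of "Suc n"] by linarith
  qed
  then show False
    by simp
qed

text \<open>Reverses \<open>1, ..., n\<close> and fixes all other indices, so that it is an
  injection on all of \<open>nat\<close> and preserves the law of the whole environment.\<close>

definition flip_env :: "nat \<Rightarrow> nat \<Rightarrow> nat" where
  "flip_env n k = (if 1 \<le> k \<and> k \<le> n then Suc n - k else k)"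

lemma inj_flip_env: "inj (flip_env n)"
  by (auto simp: inj_def flip_env_def split: if_splits)

lemma tree_fwd_flip_env: "tree_fwd (\<lambda>k. e (flip_env n k)) n = tree_rev e n"
proof -
  have "map (\<lambda>k. e (flip_env n k)) [1..<Suc n] = map e (rev [1..<Suc n])"
    by (rule nth_equalityI) (auto simp: rev_nth flip_env_def Suc_diff_Suc simp del: upt_Suc)
  then show ?thesis
    unfolding tree_fwd_LFs tree_rev_LFs by simp
qed

lemma good_env_flip: "good_env e \<Longrightarrow> good_env (\<lambda>k. e (flip_env n k))"
  by (auto simp: good_env_def flip_env_def)

text \<open>Exchangeability gives the forward and the reversed probability the same expectation. The
  reversed one tends to 0 almost surely and is bounded by 1, so dominated convergence
  applies.\<close>

lemma tendsto_expectation_tree_fwd: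
  assumes supp: "AE x in D. admissible x"
    and conv: "AE e in P. convergent (Rinv_env e)"
    and ms: "\<And>n. 1 \<le> n \<Longrightarrow> ms n \<le> n" "filterlim (\<lambda>n. n - ms n) at_top sequentially"
  shows "(\<lambda>n. \<integral>e. qcond_prob (tree_fwd e n) {T. Zred T (ms n) > 1} {T. gen_size T n > 0} \<partial>P) \<longlonglongrightarrow> 0"
proof -
  interpret P: prob_space P
    by (rule prob_P)
  let ?F = "\<lambda>n e. qcond_prob (tree_fwd e n) {T. Zred T (ms n) > 1} {T. gen_size T n > 0}"
  let ?H = "\<lambda>n e. qcond_prob (tree_rev e n) {T. Zred T (ms n) > 1} {T. gen_size T n > 0}"
  \<comment> \<open>An explicitly measurable expression that agrees with \<open>?F n\<close> on good
    environments.\<close>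
  define G where "G n e = R_env e (ms n) / (Pi_env e n + R_env e n)" for n e
  have [measurable]: "G n \<in> borel_measurable P" for n
    unfolding G_def[abs_def] by measurable
  have G_eq: "?F n e = G n e" if "good_env e" "1 \<le> n" for e n
    unfolding G_def by (rule qcond_tree_fwd) (use that ms in auto)
  have G_flip: "?H n e = G n (\<lambda>k. e (flip_env n k))" if "good_env e" "1 \<le> n" for e n
    using G_eq[OF good_env_flip[OF that(1), of n] that(2)] by (simp add: tree_fwd_flip_env)
  have [measurable]: "(\<lambda>e k. e (flip_env n k)) \<in> measurable P P" for n
    by (rule measurable_PiM_single') (auto simp: space_P space_D intro: measurable_component_singleton)
  have int_flip: "(\<integral>e. G n (\<lambda>k. e (flip_env n k)) \<partial>P) = (\<integral>e. G n e \<partial>P)" for n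
    using integral_distr[of "\<lambda>e k. e (flip_env n k)" P P "G n"] by (simp add: distr_reindex inj_flip_env)
  \<comment> \<open>The shift to \<open>Suc n\<close> is made because \<open>ms n \<le> n\<close> is
    available only from \<open>n = 1\<close> on.\<close>
  have "(\<lambda>n. \<integral>e. G (Suc n) (\<lambda>k. e (flip_env (Suc n) k)) \<partial>P) \<longlonglongrightarrow> (\<integral>e. 0 \<partial>P)"
  proof (rule integral_dominated_convergence[where w = "\<lambda>_. 1"])
    show "AE e in P. (\<lambda>n. G (Suc n) (\<lambda>k. e (flip_env (Suc n) k))) \<longlonglongrightarrow> 0"
      using conv AE_good_env[OF supp]
    proof eventually_elim
      case (elim e)
      show ?case
        using LIMSEQ_Suc[OF tendsto_qcond_tree_rev[OF elim(2,1) ms]] G_flip[OF elim(2)] by simp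
    qed
    show "AE e in P. norm (G (Suc n) (\<lambda>k. e (flip_env (Suc n) k))) \<le> 1" for n
      using AE_good_env[OF supp]
    proof eventually_elim
      case (elim e)
      then show ?case
        using G_flip[OF elim, of "Suc n", symmetric] by (simp add: qcond_prob_bounds)
    qed
  qed auto
  then have "(\<lambda>n. \<integral>e. G (Suc n) e \<partial>P) \<longlonglongrightarrow> 0"
    by (simp add: int_flip)
  then have lim: "(\<lambda>n. \<integral>e. G n e \<partial>P) \<longlonglongrightarrow> 0"
    by (rule LIMSEQ_imp_Suc)
  have "norm (\<integral>e. ?F n e \<partial>P) \<le> (\<integral>e. G n e \<partial>P)" if n: "1 \<le> n" for n
  proof -
    have AE_eq: "AE e in P. ?F n e = G n e"
      using AE_good_env[OF supp] by eventually_elim (rule G_eq[OF _ n])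
    then have "AE e in P. 0 \<le> G n e"
      by eventually_elim (metis qcond_prob_bounds(1))
    then have nonneg: "0 \<le> (\<integral>e. G n e \<partial>P)"
      by (rule integral_nonneg_AE)
    \<comment> \<open>No measurability of \<open>?F n\<close> is needed: if it fails, the Bochner integral is 0 by convention.\<close>
    show ?thesis
    proof (cases "integrable P (?F n)")
      case True
      then have "(\<integral>e. ?F n e \<partial>P) = (\<integral>e. G n e \<partial>P)"
        using AE_eq by (intro integral_cong_AE) auto
      then show ?thesis
        using nonneg by simp
    next
      case False
      then show ?thesis
        using nonneg by (simp add: not_integrable_integral_eq)
    qed
  qed
  then show ?thesis
    by (intro Lim_null_comparison[OF eventually_sequentiallyI[of 1] lim])
qed

end

section \<open>Transfer of the deterministic limits to almost every environment\<close>

theorem theorem3p4: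
  fixes D :: "(real \<times> real) measure"
  assumes D_prob: "prob_space D"
    and D_sets: "sets D = sets borel"
    and D_supp: "AE x in D. fst x > 0 \<and> snd x > 0 \<and> fst x + snd x \<ge> 1"
    and subcrit: "AE e in PiM UNIV (\<lambda>_::nat. D).
                    convergent (Rinv_env e) \<and> filterlim (R_env e) at_top sequentially"
  shows
    "(\<forall>ms :: nat \<Rightarrow> nat.
        (\<forall>n\<ge>1. ms n \<le> n) \<and> filterlim (\<lambda>n. n - ms n) at_top sequentially \<longrightarrow>
          ((\<lambda>n. \<integral>e. qcond_prob (tree_fwd e n) {T. Zred T (ms n) > 1} {T. gen_size T n > 0}
                 \<partial>PiM UNIV (\<lambda>_::nat. D)) \<longlonglongrightarrow> 0)
        \<and> (AE e in PiM UNIV (\<lambda>_::nat. D).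
             (\<lambda>n. qcond_prob (tree_rev e n) {T. Zred T (ms n) > 1} {T. gen_size T n > 0})
               \<longlonglongrightarrow> 0)
        \<and> (limsup (\<lambda>n. ereal (real (ms n) / real n)) < 1
           \<and> (\<integral>\<^sup>+ x. ennreal ((ln (fst x))\<^sup>2) \<partial>D) < \<infinity>
           \<and> (\<integral>\<^sup>+ x. ennreal ((ln (snd x))\<^sup>2) \<partial>D) < \<infinity> \<longrightarrow>
           (AE e in PiM UNIV (\<lambda>_::nat. D).
             (\<lambda>n. qcond_prob (tree_fwd e n) {T. Zred T (ms n) > 1} {T. gen_size T n > 0})
               \<longlonglongrightarrow> 0)))
     \<and> (\<forall>m::nat. AE e in PiM UNIV (\<lambda>_::nat. D).
          (\<lambda>n. SUP S :: nat list set.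
              \<bar>qcond_prob (tree_rev e n) {T. map (Zred T) [n - m..<Suc n] \<in> S} {T. gen_size T n > 0}
               - measure_pmf.prob (Zstar_law e m) S\<bar>) \<longlonglongrightarrow> 0)"
proof -
  interpret iid_env D
    by (rule iid_env.intro) (use D_prob D_sets in \<open>auto simp: iid_env_axioms_def\<close>)
  have supp: "AE x in D. admissible x"
    using D_supp by (simp add: admissible_def)
  have conv: "AE e in P. convergent (Rinv_env e)"
    using subcrit by auto
  note good = AE_good_env[OF supp]
  have sq_int: "integrable D (\<lambda>x. (f x)\<^sup>2)"
    if "f \<in> borel_measurable borel" "(\<integral>\<^sup>+ x. ennreal ((f x)\<^sup>2) \<partial>D) < \<infinity>"
    for f :: "real \<times> real \<Rightarrow> real"
    using that measurable_D[OF that(1)] by (intro integrableI_bounded) auto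
  have rev: "AE e in P. (\<lambda>n. qcond_prob (tree_rev e n) {T. Zred T (ms n) > 1} {T. gen_size T n > 0}) \<longlonglongrightarrow> 0"
    if "\<And>n. 1 \<le> n \<Longrightarrow> ms n \<le> n" "filterlim (\<lambda>n. n - ms n) at_top sequentially" for ms
    using good conv by eventually_elim (rule tendsto_qcond_tree_rev[OF _ _ that])
  have fwd: "AE e in P. (\<lambda>n. qcond_prob (tree_fwd e n) {T. Zred T (ms n) > 1} {T. gen_size T n > 0}) \<longlonglongrightarrow> 0"
    if ms: "\<And>n. 1 \<le> n \<Longrightarrow> ms n \<le> n" "limsup (\<lambda>n. ereal (real (ms n) / real n)) < 1"
      and A: "(\<integral>\<^sup>+ x. ennreal ((ln (fst x))\<^sup>2) \<partial>D) < \<infinity>"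
      and B: "(\<integral>\<^sup>+ x. ennreal ((ln (snd x))\<^sup>2) \<partial>D) < \<infinity>" for ms
  proof -
    have sqA: "integrable D (\<lambda>x. (ln (fst x))\<^sup>2)" and sqB: "integrable D (\<lambda>x. (ln (snd x))\<^sup>2)"
      using sq_int[OF measurable_ln_fst_snd(1) A] sq_int[OF measurable_ln_fst_snd(2) B] by auto
    have \<mu>: "0 < (\<integral>x. ln (fst x) \<partial>D)"
      by (rule ln_mean_pos[OF supp conv sqA])
    have "AE e in P. (\<lambda>n. (\<Sum>k<n. ln (fst (e (Suc k)))) / real n) \<longlonglongrightarrow> (\<integral>x. ln (fst x) \<partial>D)"
      by (rule strong_law_coord[OF measurable_ln_fst_snd(1) sqA])
    moreover have "AE e in P. (\<lambda>n. (\<Sum>k<n. ln (snd (e (Suc k)))) / real n) \<longlonglongrightarrow> (\<integral>x. ln (snd x) \<partial>D)"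
      by (rule strong_law_coord[OF measurable_ln_fst_snd(2) sqB])
    ultimately show ?thesis
      using good by eventually_elim (rule tendsto_qcond_tree_fwd[OF _ ms _ \<mu>])
  qed
  have tv: "AE e in P. (\<lambda>n. SUP S :: nat list set.
              \<bar>qcond_prob (tree_rev e n) {T. map (Zred T) [n - m..<Suc n] \<in> S} {T. gen_size T n > 0}
               - measure_pmf.prob (Zstar_law e m) S\<bar>) \<longlonglongrightarrow> 0" for m
    using good conv by eventually_elim (rule tendsto_tv_tree_rev)
  show ?thesis
  proof (intro conjI allI impI; (elim conjE)?)
    fix ms :: "nat \<Rightarrow> nat"
    assume "\<forall>n\<ge>1. ms n \<le> n" and lim: "filterlim (\<lambda>n. n - ms n) at_top sequentially"
    then have ms: "\<And>n. 1 \<le> n \<Longrightarrow> ms n \<le> n"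
      by blast
    show "(\<lambda>n. \<integral>e. qcond_prob (tree_fwd e n) {T. Zred T (ms n) > 1} {T. gen_size T n > 0} \<partial>P) \<longlonglongrightarrow> 0"
      by (rule tendsto_expectation_tree_fwd[OF supp conv ms lim])
    show "AE e in P. (\<lambda>n. qcond_prob (tree_rev e n) {T. Zred T (ms n) > 1} {T. gen_size T n > 0}) \<longlonglongrightarrow> 0"
      by (rule rev[OF ms lim])
    assume sup: "limsup (\<lambda>n. ereal (real (ms n) / real n)) < 1"
      and A: "(\<integral>\<^sup>+ x. ennreal ((ln (fst x))\<^sup>2) \<partial>D) < \<infinity>"
      and B: "(\<integral>\<^sup>+ x. ennreal ((ln (snd x))\<^sup>2) \<partial>D) < \<infinity>"
    show "AE e in P. (\<lambda>n. qcond_prob (tree_fwd e n) {T. Zred T (ms n) > 1} {T. gen_size T n > 0}) \<longlonglongrightarrow> 0"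
      by (rule fwd[OF ms sup A B])
  next
    fix m :: nat
    show "AE e in P. (\<lambda>n. SUP S :: nat list set.
              \<bar>qcond_prob (tree_rev e n) {T. map (Zred T) [n - m..<Suc n] \<in> S} {T. gen_size T n > 0}
               - measure_pmf.prob (Zstar_law e m) S\<bar>) \<longlonglongrightarrow> 0"
      by (rule tv)
  qed
qed

end
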